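(* Let $0<H<1$, fix a time horizon $T>0$, and for $\epsilon>0$ let $X^\epsilon$ be the kinetic fractional Brownian motion (defined in the context). For $\delta=T/n$ with $n\in\mathbb{N}$, let $$\hat{H}_{\delta,\epsilon}=\frac12-\frac{1}{2\ln(2)}\ln\left(\frac{\sum_{k=2}^{2n}\left(\Delta^{(2)}_{k,\delta/2}X^\epsilon\right)^2}{\sum_{k=2}^{n}\left(\Delta^{(2)}_{k,\delta}X^\epsilon\right)^2}\right),$$ where $\Delta^{(2)}_{k,\delta}X=X_{k\delta}-2X_{(k-1)\delta}+X_{(k-2)\delta}$ denotes the second-order differences. Assume that $\delta=\delta(\epsilon)$ is such that $\delta(\epsilon)\to0$ and $\epsilon/\delta(\epsilon)\to0$ as $\epsilon\to0^+$. Then $$\hat{H}_{\delta,\epsilon}\longrightarrow H\quad\text{in probability as }\epsilon\to0^+.$$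
   Context: Fractional Brownian motion: $(B^H_t)_{t\in\mathbb{R}}$ is a (two-sided) fractional Brownian motion of Hurst index $H\in(0,1)$, i.e. a continuous centred Gaussian process with $\mathbb{E}[B^H_tB^H_s]=\frac12(|t|^{2H}+|s|^{2H}-|t-s|^{2H})$. Kinetic fractional Brownian motion: for fixed $\epsilon>0$, nonzero real constants $\sigma_1,\sigma_2$ and $x_0\in\mathbb{R}$, $(X^\epsilon_t)_{t\ge0}$ is the solution of the system $$dX^\epsilon_t=\sigma_1\epsilon^{H-1}Y^\epsilon_t\,dt,\quad X^\epsilon_0=x_0,$$ $$dY^\epsilon_t=-\frac1\epsilon Y^\epsilon_t\,dt+\frac{\sigma_2}{\epsilon^H}\,dB^H_t,\quad Y^\epsilon_0=\epsilon^{-H}\sigma_2\int_{-\infty}^0 e^{s/\epsilon}\,dB^H_s,$$ so that $Y^\epsilon$ is the stationary fractional Ornstein-Uhlenbeck process $Y^\epsilon_t=\epsilon^{-H}\sigma_2\int_{-\infty}^t e^{-(t-s)/\epsilon}dB^H_s$. The process is observed on $[0,T]$ with $T$ fixed; $\delta(\epsilon)$ takes values of the form $T/n$ with $n=n(\epsilon)\in\mathbb{N}$, $n\ge2$. *)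

theory Defs
  imports "HOL-Probability.Probability"
begin

text \<open>Gaussian laws may be degenerate: a constant is Gaussian with variance zero.\<close>

definition gaussian_rv :: "'a measure \<Rightarrow> ('a \<Rightarrow> real) \<Rightarrow> bool" where
  "gaussian_rv M Z \<longleftrightarrow> Z \<in> borel_measurable M \<and>
     (\<exists>m. (AE \<omega> in M. Z \<omega> = m) \<or> (\<exists>s>0. distributed M lborel Z (normal_density m s)))"

definition gaussian_process :: "'a measure \<Rightarrow> ('i \<Rightarrow> 'a \<Rightarrow> real) \<Rightarrow> bool" where
  "gaussian_process M B \<longleftrightarrow>
     (\<forall>J c. finite J \<longrightarrow> gaussian_rv M (\<lambda>\<omega>. \<Sum>t\<in>J. c t * B t \<omega>))"

definition fractional_brownian_motion ::
    "'a measure \<Rightarrow> real \<Rightarrow> (real \<Rightarrow> 'a \<Rightarrow> real) \<Rightarrow> bool" where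
  "fractional_brownian_motion M H B \<longleftrightarrow>
     gaussian_process M B \<and>
     (AE \<omega> in M. continuous_on UNIV (\<lambda>t. B t \<omega>)) \<and>
     (\<forall>t. integral\<^sup>L M (B t) = 0) \<and>
     (\<forall>t s. integral\<^sup>L M (\<lambda>\<omega>. B t \<omega> * B s \<omega>) =
        1 / 2 * (\<bar>t\<bar> powr (2 * H) + \<bar>s\<bar> powr (2 * H) - \<bar>t - s\<bar> powr (2 * H)))"

text \<open>
  Integrals against fractional Brownian motion are pathwise Riemann--Stieltjes integrals.
  The gauge is a ball of constant radius, so this is the Riemann (not the Henstock) notion:
  the sums converge as the mesh of the tagged division tends to zero.
\<close>

definition has_RS_integral ::
    "(real \<Rightarrow> real) \<Rightarrow> (real \<Rightarrow> real) \<Rightarrow> real \<Rightarrow> real \<Rightarrow> real \<Rightarrow> bool" where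
  "has_RS_integral f g a b I \<longleftrightarrow>
     (\<forall>e>0. \<exists>d>0. \<forall>p. p tagged_division_of {a..b} \<longrightarrow> (\<lambda>x. ball x d) fine p \<longrightarrow>
        \<bar>(\<Sum>(x, K)\<in>p. f x * (g (Sup K) - g (Inf K))) - I\<bar> < e)"

text \<open>The integral of \<open>f\<close> against \<open>dg\<close> over \<open>(-\<infinity>, b]\<close>, as an improper integral.\<close>

definition has_RS_integral_atMost ::
    "(real \<Rightarrow> real) \<Rightarrow> (real \<Rightarrow> real) \<Rightarrow> real \<Rightarrow> real \<Rightarrow> bool" where
  "has_RS_integral_atMost f g b I \<longleftrightarrow>
     (\<exists>J. (\<forall>a\<le>b. has_RS_integral f g a b (J a)) \<and> (J \<longlongrightarrow> I) at_bot)"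

text \<open>
  Both equations are written in integrated form; since the noise is additive,
  the integral of \<open>dB\<close> over \<open>[0, t]\<close> is the increment of \<open>B\<close>.
\<close>

definition kinetic_fBm ::
    "'a measure \<Rightarrow> (real \<Rightarrow> 'a \<Rightarrow> real) \<Rightarrow> real \<Rightarrow> real \<Rightarrow> real \<Rightarrow> real \<Rightarrow> real \<Rightarrow>
      (real \<Rightarrow> 'a \<Rightarrow> real) \<Rightarrow> (real \<Rightarrow> 'a \<Rightarrow> real) \<Rightarrow> bool" where
  "kinetic_fBm M B H \<sigma>1 \<sigma>2 x0 \<epsilon> X Y \<longleftrightarrow>
     (\<forall>t\<ge>0. X t \<in> borel_measurable M \<and> Y t \<in> borel_measurable M) \<and>
     (AE \<omega> in M.
        continuous_on {0..} (\<lambda>t. Y t \<omega>) \<and>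
        (\<exists>I. has_RS_integral_atMost (\<lambda>s. exp (s / \<epsilon>)) (\<lambda>s. B s \<omega>) 0 I \<and>
             Y 0 \<omega> = \<epsilon> powr (- H) * \<sigma>2 * I) \<and>
        (\<forall>t\<ge>0. Y t \<omega> = Y 0 \<omega> + integral {0..t} (\<lambda>s. - (1 / \<epsilon>) * Y s \<omega>)
                        + \<sigma>2 / \<epsilon> powr H * (B t \<omega> - B 0 \<omega>)) \<and>
        (\<forall>t\<ge>0. X t \<omega> = x0 + integral {0..t} (\<lambda>s. \<sigma>1 * \<epsilon> powr (H - 1) * Y s \<omega>)))"

definition second_diff :: "(real \<Rightarrow> real) \<Rightarrow> real \<Rightarrow> nat \<Rightarrow> real" where
  "second_diff x \<delta> k = x (real k * \<delta>) - 2 * x ((real k - 1) * \<delta>) + x ((real k - 2) * \<delta>)"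

text \<open>
  If one of the sums vanishes, the value is a junk value determined by the conventions
  \<open>a / 0 = 0\<close> and \<open>ln 0 = 0\<close>.
\<close>

definition hurst_estimator :: "nat \<Rightarrow> real \<Rightarrow> (real \<Rightarrow> real) \<Rightarrow> real" where
  "hurst_estimator n \<delta> x =
     1 / 2 - 1 / (2 * ln 2) *
       ln ((\<Sum>k=2..2*n. (second_diff x (\<delta> / 2) k)\<^sup>2) / (\<Sum>k=2..n. (second_diff x \<delta> k)\<^sup>2))"

text \<open>
  Measurability is part of the notion, because \<^const>\<open>measure\<close> is \<open>0\<close> on nonmeasurable sets.
\<close>

definition tendsto_in_prob ::
    "'a measure \<Rightarrow> ('i \<Rightarrow> 'a \<Rightarrow> real) \<Rightarrow> real \<Rightarrow> 'i filter \<Rightarrow> bool" where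
  "tendsto_in_prob M Z c F \<longleftrightarrow>
     (\<forall>\<^sub>F i in F. Z i \<in> borel_measurable M) \<and>
     (\<forall>\<eta>>0. ((\<lambda>i. measure M {\<omega> \<in> space M. \<bar>Z i \<omega> - c\<bar> > \<eta>}) \<longlongrightarrow> 0) F)"

end

theory Submission
  imports Defs "HOL-Real_Asymp.Real_Asymp"
begin

text \<open>
  Integrating the second equation of the system shows that, almost surely and for all \<open>t \<ge> 0\<close>,
  \<open>X t = x0 + \<sigma>1 * \<sigma>2 * ((B t - B 0) - (D t - D 0))\<close> with \<open>D t = \<epsilon> powr H * Y t / \<sigma>2\<close>, which is the
  integral of \<open>exp (-(t - s) / \<epsilon>)\<close> against \<open>dB\<close> over \<open>(-\<infinity>, t]\<close>.  The second
  differences of \<open>X\<close> are therefore a multiple of those of \<open>B\<close> minus those of \<open>D\<close>.  The second moment of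
  \<open>D\<close> is at most of order \<open>\<epsilon> powr (2 * H)\<close>, while the second differences of \<open>B\<close> at step \<open>\<delta>\<close> have variance
  \<open>(4 - 2 powr (2 * H)) * \<delta> powr (2 * H)\<close>.  As \<open>\<epsilon> / \<delta>\<close> tends to \<open>0\<close>, the contribution of \<open>D\<close> disappears
  after division by \<open>\<delta> powr (2 * H)\<close>.

  Two estimates carry the argument.  The first is the law of large numbers for the squared second
  differences of \<open>B\<close> (\<open>scaled_variation_B_tendsto\<close>).  For centred jointly Gaussian \<open>U\<close> and \<open>W\<close> the
  covariance of \<open>U\<^sup>2\<close> and \<open>W\<^sup>2\<close> is twice the square of the covariance of \<open>U\<close> and \<open>W\<close>
  (\<open>gaussian_space_products\<close>); by stationarity and self-similarity the latter only depends on the lag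
  and on a power of the step (\<open>second_diff_covariance\<close>), and it vanishes as the lag grows
  (\<open>second_diff_cov_tendsto_0\<close>).  A Cesaro argument then makes the variance of the empirical mean
  tend to \<open>0\<close> along every choice of steps.

  The second estimate is the bound on \<open>D\<close> (\<open>D_second_moment\<close>).  Summation by parts writes the
  integral of an exponential against \<open>dB\<close> over a bounded interval as a limit of averages of
  increments \<open>B b - B s\<close> with nonnegative weights of total mass \<open>1\<close>.  Convexity of the square and a
  telescoping bound for the weights control the finite sums, and Fatou's lemma passes to the limit;
  working with finite sums throughout avoids any question of joint measurability of \<open>B\<close>.

  Together they show that the scaled variations at the steps \<open>\<delta>\<close> and \<open>\<delta> / 2\<close> both converge in
  probability to the same positive constant (\<open>scaled_variation_X_tendsto\<close>).  The estimator is a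
  continuous function of these two numbers near their limit (\<open>hurst_estimator_eq\<close>), with value
  \<open>H\<close> there.
\<close>

section \<open>Exponential averaging weights\<close>

text \<open>
  The function \<open>exp x * (x\<^sup>2 - 2 * x + 3)\<close> is the antiderivative of \<open>exp x * (1 + x\<^sup>2)\<close>.  On
  \<open>[u, v]\<close> the factor \<open>1 + x\<^sup>2\<close> is smallest at \<open>v\<close>, because \<open>v \<le> 0\<close>, so the step of the exponential
  times this smallest value is dominated by the increment of the antiderivative; such bounds
  telescope.
\<close>
lemma exp_second_moment_step:
  fixes u v :: real
  assumes "u \<le> v" "v \<le> 0"
  shows "(exp v - exp u) * (1 + v\<^sup>2) \<le> exp v * (v\<^sup>2 - 2 * v + 3) - exp u * (u\<^sup>2 - 2 * u + 3)"
proof -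
  define g where "g x = exp x * (x\<^sup>2 - 2 * x + 3) - (1 + v\<^sup>2) * exp x" for x :: real
  have "g u \<le> g v"
  proof (rule DERIV_nonneg_imp_nondecreasing[OF assms(1)])
    fix x assume x: "u \<le> x" "x \<le> v"
    have "(g has_real_derivative exp x * (x\<^sup>2 - v\<^sup>2)) (at x)"
      unfolding g_def by (auto intro!: derivative_eq_intros simp: algebra_simps)
    moreover have "v\<^sup>2 \<le> x\<^sup>2"
      using x assms by (simp add: abs_le_square_iff[symmetric])
    ultimately show "\<exists>y. (g has_real_derivative y) (at x) \<and> 0 \<le> y"
      by (intro exI[of _ "exp x * (x\<^sup>2 - v\<^sup>2)"]) auto
  qed
  then show ?thesis by (simp add: g_def algebra_simps)
qed

lemma powr_le_one_plus_square:
  fixes u p :: real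
  assumes "0 \<le> u" "p \<le> 2" "0 \<le> p"
  shows "u powr p \<le> 1 + u\<^sup>2"
proof (cases "u \<le> 1")
  case True
  then have "u powr p \<le> 1" using assms by (simp add: powr_le1)
  then show ?thesis by (smt (verit) zero_le_power2)
next
  case False
  then have "u powr p \<le> u powr 2" using assms by (intro powr_mono) auto
  also have "\<dots> = u\<^sup>2" using False by simp
  finally show ?thesis by simp
qed

text \<open>
  The masses that the measure with density \<open>exp ((x - b) / \<epsilon>) / \<epsilon>\<close> on \<open>(-\<infinity>, b]\<close> gives to the cells
  \<open>(s (i - 1), s i]\<close> of a partition; the whole tail \<open>(-\<infinity>, s 0]\<close> is put on the first node.
\<close>
definition kernel_weight :: "real \<Rightarrow> real \<Rightarrow> (nat \<Rightarrow> real) \<Rightarrow> nat \<Rightarrow> real" where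
  "kernel_weight \<epsilon> b s i =
     (if i = 0 then exp ((s 0 - b) / \<epsilon>) else exp ((s i - b) / \<epsilon>) - exp ((s (i - 1) - b) / \<epsilon>))"

lemma sum_kernel_weight:
  "(\<Sum>i\<le>m. kernel_weight \<epsilon> b s i) = exp ((s m - b) / \<epsilon>)"
  by (induction m) (auto simp: kernel_weight_def)

lemma kernel_weight_nonneg:
  assumes "0 < \<epsilon>" "mono s"
  shows "0 \<le> kernel_weight \<epsilon> b s i"
  using assms monoD[OF assms(2), of "i - 1" i] by (auto simp: kernel_weight_def divide_right_mono)

text \<open>
  In the variable \<open>(s i - b) / \<epsilon>\<close> the scale factor \<open>\<epsilon> powr p\<close> comes out, and the \<open>p\<close>-th power is
  dominated by \<open>1 + x\<^sup>2\<close>, for which the sum telescopes to the value \<open>3\<close> of the antiderivative at \<open>0\<close>.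
\<close>
lemma kernel_weight_moment:
  assumes "0 < \<epsilon>" "mono s" "s m \<le> b" "0 \<le> p" "p \<le> 2"
  shows "(\<Sum>i\<le>m. kernel_weight \<epsilon> b s i * \<bar>b - s i\<bar> powr p) \<le> 3 * \<epsilon> powr p"
proof -
  define x where "x i = (s i - b) / \<epsilon>" for i
  define P where "P x = exp x * (x\<^sup>2 - 2 * x + 3)" for x :: real
  have x_le: "x i \<le> 0" if "i \<le> m" for i
    using monoD[OF assms(2) that] assms by (auto simp: x_def divide_nonpos_pos)
  have x_mono: "x i \<le> x (Suc i)" for i
    using monoD[OF assms(2), of i "Suc i"] assms(1) by (auto simp: x_def divide_right_mono)
  have "(\<Sum>i\<le>m. kernel_weight \<epsilon> b s i * (1 + (x i)\<^sup>2)) \<le> P (x m)"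
    using x_le
  proof (induction m)
    case 0
    have "exp (x 0) * (1 + (x 0)\<^sup>2) \<le> exp (x 0) * ((x 0)\<^sup>2 - 2 * x 0 + 3)"
      using 0[of 0] by (intro mult_left_mono) auto
    then show ?case by (simp add: kernel_weight_def P_def x_def)
  next
    case (Suc m)
    have "kernel_weight \<epsilon> b s (Suc m) * (1 + (x (Suc m))\<^sup>2) \<le> P (x (Suc m)) - P (x m)"
      using exp_second_moment_step[OF x_mono Suc.prems, of m]
      by (simp add: kernel_weight_def P_def x_def)
    with Suc.IH Suc.prems show ?case by force
  qed
  also have "P (x m) \<le> 3"
  proof -
    have "1 - exp (x m) \<le> 3 - P (x m)"
      using exp_second_moment_step[of "x m" 0] x_le[of m] by (simp add: P_def)
    moreover have "exp (x m) \<le> 1" using x_le[of m] by simp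
    ultimately show ?thesis by linarith
  qed
  finally have moment: "(\<Sum>i\<le>m. kernel_weight \<epsilon> b s i * (1 + (x i)\<^sup>2)) \<le> 3" .
  have "(\<Sum>i\<le>m. kernel_weight \<epsilon> b s i * \<bar>b - s i\<bar> powr p)
      \<le> (\<Sum>i\<le>m. \<epsilon> powr p * (kernel_weight \<epsilon> b s i * (1 + (x i)\<^sup>2)))"
  proof (rule sum_mono)
    fix i
    have "\<bar>b - s i\<bar> = \<epsilon> * \<bar>x i\<bar>" using assms(1) by (simp add: x_def abs_minus_commute)
    then have "\<bar>b - s i\<bar> powr p = \<epsilon> powr p * \<bar>x i\<bar> powr p"
      using assms(1) by (simp add: powr_mult)
    also have "\<dots> \<le> \<epsilon> powr p * (1 + (x i)\<^sup>2)"
      using powr_le_one_plus_square[of "\<bar>x i\<bar>" p] assms by (intro mult_left_mono) auto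
    finally show "kernel_weight \<epsilon> b s i * \<bar>b - s i\<bar> powr p
        \<le> \<epsilon> powr p * (kernel_weight \<epsilon> b s i * (1 + (x i)\<^sup>2))"
      using mult_left_mono[OF _ kernel_weight_nonneg[OF assms(1,2), of b i]]
      by (metis mult.left_commute)
  qed
  also have "\<dots> \<le> \<epsilon> powr p * 3"
    unfolding sum_distrib_left[symmetric] using moment by (intro mult_left_mono) auto
  finally show ?thesis by simp
qed

lemma square_weighted_sum_le:
  fixes w c :: "'i \<Rightarrow> real"
  assumes "\<And>i. i \<in> I \<Longrightarrow> 0 \<le> w i" "(\<Sum>i\<in>I. w i) \<le> 1"
  shows "(\<Sum>i\<in>I. w i * c i)\<^sup>2 \<le> (\<Sum>i\<in>I. w i * (c i)\<^sup>2)"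
proof -
  have "(\<Sum>i\<in>I. w i * c i)\<^sup>2 = (\<Sum>i\<in>I. sqrt (w i) * (sqrt (w i) * c i))\<^sup>2"
    using assms(1) by (intro arg_cong[of _ _ "\<lambda>x. x\<^sup>2"] sum.cong) (auto simp flip: mult.assoc)
  also have "\<dots> \<le> (\<Sum>i\<in>I. (sqrt (w i))\<^sup>2) * (\<Sum>i\<in>I. (sqrt (w i) * c i)\<^sup>2)"
    by (rule Cauchy_Schwarz_ineq_sum)
  also have "\<dots> = (\<Sum>i\<in>I. w i) * (\<Sum>i\<in>I. w i * (c i)\<^sup>2)"
    using assms(1) by (simp add: power_mult_distrib)
  also have "\<dots> \<le> 1 * (\<Sum>i\<in>I. w i * (c i)\<^sup>2)"
    using assms by (intro mult_right_mono sum_nonneg) auto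
  finally show ?thesis by simp
qed

section \<open>Riemann--Stieltjes sums on uniform grids\<close>

definition grid :: "real \<Rightarrow> real \<Rightarrow> nat \<Rightarrow> nat \<Rightarrow> real" where
  "grid a b m i = a + real i * ((b - a) / real m)"

lemma grid_0 [simp]: "grid a b m 0 = a"
  by (simp add: grid_def)

lemma grid_last: "0 < m \<Longrightarrow> grid a b m m = b"
  by (simp add: grid_def)

lemma grid_Suc: "grid a b m (Suc i) = grid a b m i + (b - a) / real m"
  by (simp add: grid_def add_divide_distrib diff_divide_distrib algebra_simps)

lemma mono_grid: "a \<le> b \<Longrightarrow> mono (grid a b m)"
  unfolding mono_def grid_def by (intro allI impI add_left_mono mult_right_mono) auto

lemma grid_mem: "a \<le> b \<Longrightarrow> i \<le> m \<Longrightarrow> 0 < m \<Longrightarrow> grid a b m i \<in> {a..b}"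
  using monoD[OF mono_grid, of a b 0 i m] monoD[OF mono_grid, of a b i m m]
  by (auto simp: grid_last)

text \<open>
  On each cell, \<open>F * c - Q\<close> with \<open>c\<close> the value of \<open>C\<close> at the right end has derivative
  \<open>F' x * (c - C x)\<close>, which uniform continuity makes small; the mean value theorem bounds the error of
  the cell by a small multiple of its length.  Stating the limit by a primitive \<open>Q\<close> leaves the
  integral itself out of the argument.
\<close>
lemma stieltjes_sums_tendsto:
  fixes F F' C Q :: "real \<Rightarrow> real"
  assumes "a \<le> b"
    and F: "\<And>x. x \<in> {a..b} \<Longrightarrow> (F has_real_derivative F' x) (at x within {a..b})"
    and Q: "\<And>x. x \<in> {a..b} \<Longrightarrow> (Q has_real_derivative F' x * C x) (at x within {a..b})"
    and C: "continuous_on {a..b} C"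
    and K: "\<And>x. x \<in> {a..b} \<Longrightarrow> \<bar>F' x\<bar> \<le> K"
  shows "(\<lambda>m. \<Sum>i<m. (F (grid a b m (Suc i)) - F (grid a b m i)) * C (grid a b m (Suc i)))
           \<longlonglongrightarrow> Q b - Q a"
proof (rule LIMSEQ_I)
  fix e :: real assume "0 < e"
  have "0 \<le> K" using K[of a] assms(1) by auto
  \<comment> \<open>The two summands \<open>1\<close> keep the denominator positive when \<open>K = 0\<close> or \<open>a = b\<close>.\<close>
  define e' where "e' = e / ((K + 1) * (b - a + 1))"
  have "0 < e'" using \<open>0 < e\<close> \<open>0 \<le> K\<close> assms(1) by (simp add: e'_def)
  have "uniformly_continuous_on {a..b} C"
    using C by (intro compact_uniformly_continuous) auto
  then obtain d where "0 < d"
    and d: "\<And>x y. x \<in> {a..b} \<Longrightarrow> y \<in> {a..b} \<Longrightarrow> \<bar>y - x\<bar> < d \<Longrightarrow> \<bar>C y - C x\<bar> < e'"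
    using \<open>0 < e'\<close> unfolding uniformly_continuous_on_def dist_real_def by metis
  obtain N :: nat where N: "(b - a) / d < real N"
    using reals_Archimedean2 by blast
  show "\<exists>no. \<forall>m\<ge>no. norm ((\<Sum>i<m. (F (grid a b m (Suc i)) - F (grid a b m i)) * C (grid a b m (Suc i)))
           - (Q b - Q a)) < e"
  proof (intro exI[of _ "Suc N"] allI impI)
    fix m assume m: "Suc N \<le> m"
    then have "0 < m" by simp
    define s where "s = grid a b m"
    define h where "h = (b - a) / real m"
    have "0 \<le> h" using assms(1) by (simp add: h_def)
    have "b - a < d * real m"
      using N m \<open>0 < d\<close> by (simp add: divide_less_eq mult.commute) (smt (verit) mult_left_mono of_nat_mono Suc_leD)
    then have "h < d" using \<open>0 < m\<close> by (simp add: h_def divide_less_eq)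
    have step: "\<bar>(F (s (Suc i)) - F (s i)) * C (s (Suc i)) - (Q (s (Suc i)) - Q (s i))\<bar> \<le> K * e' * h"
      if "i < m" for i
    proof -
      have mem: "s i \<in> {a..b}" "s (Suc i) \<in> {a..b}"
        using that grid_mem[OF assms(1), of _ m] by (auto simp: s_def)
      have Suc: "s (Suc i) = s i + h" by (simp add: s_def h_def grid_Suc)
      define c where "c = C (s (Suc i))"
      define G where "G x = F x * c - Q x" for x
      have "norm (G (s (Suc i)) - G (s i)) \<le> (K * e') * norm (s (Suc i) - s i)"
      proof (rule field_differentiable_bound[where S = "{s i..s (Suc i)}" and f' = "\<lambda>x. F' x * (c - C x)"])
        fix x assume x: "x \<in> {s i..s (Suc i)}"
        then have x': "x \<in> {a..b}" using mem by auto
        have "(G has_field_derivative F' x * c - F' x * C x) (at x within {a..b})"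
          unfolding G_def by (intro DERIV_diff DERIV_cmult_right F Q x')
        then show "(G has_field_derivative F' x * (c - C x)) (at x within {s i..s (Suc i)})"
          using mem by (auto simp: algebra_simps intro: DERIV_subset)
        have "\<bar>c - C x\<bar> \<le> e'"
          unfolding c_def using d[OF x' mem(2)] x \<open>h < d\<close> Suc by force
        then show "norm (F' x * (c - C x)) \<le> K * e'"
          using K[OF x'] \<open>0 \<le> K\<close> by (auto simp: abs_mult intro!: mult_mono)
      qed (use Suc \<open>0 \<le> h\<close> in auto)
      then show ?thesis
        using Suc \<open>0 \<le> h\<close> by (simp add: G_def c_def algebra_simps)
    qed
    have "(\<Sum>i<m. Q (s (Suc i)) - Q (s i)) = Q b - Q a"
      using sum_lessThan_telescope[of "\<lambda>i. Q (s i)" m] \<open>0 < m\<close> by (simp add: s_def grid_last)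
    then have "\<bar>(\<Sum>i<m. (F (s (Suc i)) - F (s i)) * C (s (Suc i))) - (Q b - Q a)\<bar>
        = \<bar>\<Sum>i<m. (F (s (Suc i)) - F (s i)) * C (s (Suc i)) - (Q (s (Suc i)) - Q (s i))\<bar>"
      by (simp add: sum_subtractf)
    also have "\<dots> \<le> (\<Sum>i<m. K * e' * h)"
      by (intro order_trans[OF sum_abs] sum_mono step) simp
    also have "\<dots> = K * (b - a) * e'" using \<open>0 < m\<close> by (simp add: h_def)
    also have "\<dots> < (K + 1) * (b - a + 1) * e'"
      using \<open>0 < e'\<close> \<open>0 \<le> K\<close> assms(1) by (intro mult_strict_right_mono) (auto simp: algebra_simps intro: add_nonneg_pos)
    also have "\<dots> = e" using \<open>0 \<le> K\<close> assms(1) by (simp add: e'_def)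
    finally show "norm ((\<Sum>i<m. (F (grid a b m (Suc i)) - F (grid a b m i)) * C (grid a b m (Suc i)))
           - (Q b - Q a)) < e"
      by (simp add: s_def)
  qed
qed

lemma grid_tagged_division:
  assumes "a < b" "0 < m"
  defines "s \<equiv> grid a b m"
  shows "(\<lambda>i. (s i, {s i..s (Suc i)})) ` {..<m} tagged_division_of {a..b}"
proof -
  have mono: "s i \<le> s j" if "i \<le> j" for i j
    unfolding s_def using mono_grid[of a b m] assms(1) that by (auto simp: mono_def)
  have "(\<lambda>i. (s i, {s i..s (Suc i)})) ` {..<k} tagged_division_of {s 0..s k}" if "0 < k" for k
    using that
  proof (induction k)
    case (Suc k)
    have last: "{(s k, {s k..s (Suc k)})} tagged_division_of {s k..s (Suc k)}"
      using mono[of k "Suc k"] by (intro tagged_division_of_self_real) auto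
    show ?case
    proof (cases "k = 0")
      case False
      have "(\<lambda>i. (s i, {s i..s (Suc i)})) ` {..<k} \<union> {(s k, {s k..s (Suc k)})}
          tagged_division_of {s 0..s k} \<union> {s k..s (Suc k)}"
        using Suc.IH False last by (intro tagged_division_Un) (auto simp: interior_atLeastAtMost_real)
      moreover have "{s 0..s k} \<union> {s k..s (Suc k)} = {s 0..s (Suc k)}"
        using mono[of 0 k] mono[of k "Suc k"] by auto
      ultimately show ?thesis by (simp add: lessThan_Suc)
    qed (use last in \<open>simp add: lessThan_Suc\<close>)
  qed simp
  from this[OF assms(2)] show ?thesis using assms by (simp add: s_def grid_last)
qed

text \<open>
  The definition quantifies over all tagged divisions that are fine enough; the uniform grids tagged
  at left end points are among them.
\<close>
lemma has_RS_integral_grid_sums: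
  assumes "has_RS_integral f g a b I" "a < b"
  shows "(\<lambda>m. \<Sum>i<m. f (grid a b m i) * (g (grid a b m (Suc i)) - g (grid a b m i))) \<longlonglongrightarrow> I"
proof (rule LIMSEQ_I)
  fix e :: real assume "0 < e"
  then obtain d where "0 < d" and d: "\<And>p. p tagged_division_of {a..b} \<Longrightarrow> (\<lambda>x. ball x d) fine p \<Longrightarrow>
        \<bar>(\<Sum>(x, K)\<in>p. f x * (g (Sup K) - g (Inf K))) - I\<bar> < e"
    using assms(1) unfolding has_RS_integral_def by meson
  obtain N :: nat where N: "(b - a) / d < real N"
    using reals_Archimedean2 by blast
  show "\<exists>no. \<forall>m\<ge>no. norm ((\<Sum>i<m. f (grid a b m i) * (g (grid a b m (Suc i)) - g (grid a b m i))) - I) < e"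
  proof (intro exI[of _ "Suc N"] allI impI)
    fix m assume m: "Suc N \<le> m"
    then have "0 < m" by simp
    define s where "s = grid a b m"
    define p where "p = (\<lambda>i. (s i, {s i..s (Suc i)})) ` {..<m}"
    have "b - a < d * real m"
      using N m \<open>0 < d\<close> by (simp add: divide_less_eq mult.commute) (smt (verit) mult_left_mono of_nat_mono Suc_leD)
    then have h: "(b - a) / real m < d" "0 < (b - a) / real m"
      using \<open>0 < m\<close> assms(2) by (simp_all add: divide_less_eq)
    have Suc: "s (Suc i) = s i + (b - a) / real m" for i by (simp add: s_def grid_Suc)
    have "strict_mono s" using h by (auto simp: strict_mono_Suc_iff Suc)
    then have inj: "inj_on (\<lambda>i. (s i, {s i..s (Suc i)})) {..<m}"
      by (auto simp: inj_on_def strict_mono_eq)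
    have "p tagged_division_of {a..b}"
      unfolding p_def s_def by (rule grid_tagged_division[OF assms(2) \<open>0 < m\<close>])
    moreover have "(\<lambda>x. ball x d) fine p"
      unfolding p_def fine_def using h by (auto simp: Suc dist_real_def)
    ultimately have "\<bar>(\<Sum>(x, K)\<in>p. f x * (g (Sup K) - g (Inf K))) - I\<bar> < e" by (rule d)
    moreover have "(\<Sum>(x, K)\<in>p. f x * (g (Sup K) - g (Inf K)))
        = (\<Sum>i<m. f (s i) * (g (s (Suc i)) - g (s i)))"
      unfolding p_def using h by (subst sum.reindex[OF inj]) (auto simp: Suc)
    ultimately show "norm ((\<Sum>i<m. f (grid a b m i) * (g (grid a b m (Suc i)) - g (grid a b m i))) - I) < e"
      by (simp add: s_def)
  qed
qed

lemma sum_by_parts: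
  fixes f C :: "nat \<Rightarrow> real"
  shows "(\<Sum>i<m. f i * (C i - C (Suc i))) = f 0 * C 0 + (\<Sum>i<m. (f (Suc i) - f i) * C (Suc i)) - f m * C m"
  by (induction m) (auto simp: algebra_simps)

lemma kernel_weight_sum_eq:
  "(\<Sum>i\<le>m. kernel_weight \<epsilon> b s i * C i) = exp ((s 0 - b) / \<epsilon>) * C 0 +
     (\<Sum>i<m. (exp ((s (Suc i) - b) / \<epsilon>) - exp ((s i - b) / \<epsilon>)) * C (Suc i))"
  by (cases m) (simp_all add: sum.atMost_shift kernel_weight_def)

text \<open>
  Summation by parts moves the differences from \<open>g\<close> to the exponential.  There is no boundary term
  at the right end, since the summand \<open>g 0 - g s\<close> vanishes there.
\<close>
lemma RS_exp_integral_limit: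
  assumes "has_RS_integral (\<lambda>s. exp (s / \<epsilon>)) g a 0 I" "a < 0"
  shows "(\<lambda>m. \<Sum>i\<le>m. kernel_weight \<epsilon> 0 (grid a 0 m) i * (g 0 - g (grid a 0 m i))) \<longlonglongrightarrow> I"
proof -
  have "\<forall>\<^sub>F m in sequentially. (\<Sum>i<m. exp (grid a 0 m i / \<epsilon>) * (g (grid a 0 m (Suc i)) - g (grid a 0 m i)))
     = (\<Sum>i\<le>m. kernel_weight \<epsilon> 0 (grid a 0 m) i * (g 0 - g (grid a 0 m i)))"
    using eventually_gt_at_top[of 0]
  proof eventually_elim
    case (elim m)
    show ?case
      using sum_by_parts[of "\<lambda>i. exp (grid a 0 m i / \<epsilon>)" "\<lambda>i. g 0 - g (grid a 0 m i)" m] elim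
      by (simp add: kernel_weight_sum_eq grid_last)
  qed
  with has_RS_integral_grid_sums[OF assms] show ?thesis
    by (rule Lim_transform_eventually)
qed

text \<open>
  Variation of constants: the solution equals
  \<open>exp (- t / \<epsilon>) * (D 0 + B t - B 0)\<close> plus the integral of \<open>exp ((s - t) / \<epsilon>) / \<epsilon> * (B t - B s)\<close> over
  \<open>[0, t]\<close>.  The difference \<open>B t - B s\<close> in place of \<open>B s\<close> makes the small increments visible.
\<close>
lemma linear_ode_limit:
  fixes D B :: "real \<Rightarrow> real"
  assumes "0 < \<epsilon>" "0 \<le> t" and D: "continuous_on {0..} D" and B: "continuous_on UNIV B"
    and eq: "\<And>t. 0 \<le> t \<Longrightarrow> D t = D 0 + integral {0..t} (\<lambda>s. - (1 / \<epsilon>) * D s) + (B t - B 0)"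
  shows "(\<lambda>m. \<Sum>i\<le>m. kernel_weight \<epsilon> t (grid 0 t m) i * (B t - B (grid 0 t m i)))
           \<longlonglongrightarrow> D t - exp (- t / \<epsilon>) * D 0"
proof -
  define F where "F s = exp ((s - t) / \<epsilon>)" for s
  define V where "V s = integral {0..s} D" for s
  \<comment> \<open>A primitive of the integrand: the equation for \<open>D\<close> cancels all terms but \<open>B t - B x\<close>.\<close>
  define R where "R s = F s * (D 0 + (B t - B 0) - V s / \<epsilon>)" for s
  have cD: "continuous_on {0..t} D" using D by (rule continuous_on_subset) auto
  have dV: "(V has_real_derivative D x) (at x within {0..t})" if "x \<in> {0..t}" for x
    using integral_has_vector_derivative[OF cD that]
    by (simp add: V_def[abs_def] has_real_derivative_iff_has_vector_derivative)
  have eqV: "D s = D 0 - V s / \<epsilon> + (B s - B 0)" if "0 \<le> s" for s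
  proof -
    have "integral {0..s} (\<lambda>s. - (1 / \<epsilon>) * D s) = - (1 / \<epsilon>) * V s"
      unfolding V_def by (rule integral_mult_right)
    then show ?thesis using eq[OF that] by simp
  qed
  have dF: "(F has_real_derivative F x / \<epsilon>) (at x within S)" for x S
    unfolding F_def using assms(1) by (auto intro!: derivative_eq_intros)
  have "(R has_real_derivative (F x / \<epsilon>) * (B t - B x)) (at x within {0..t})" if "x \<in> {0..t}" for x
  proof -
    have "(R has_real_derivative (F x / \<epsilon>) * (D 0 + (B t - B 0) - V x / \<epsilon>) + F x * (- (D x / \<epsilon>)))
        (at x within {0..t})"
      unfolding R_def using assms(1) by (auto intro!: derivative_eq_intros dF dV that)
    moreover have "B t - B x = D 0 + (B t - B 0) - V x / \<epsilon> - D x"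
      using eqV[of x] that by simp
    then have "(F x / \<epsilon>) * (D 0 + (B t - B 0) - V x / \<epsilon>) + F x * (- (D x / \<epsilon>)) = (F x / \<epsilon>) * (B t - B x)"
      by (simp only: right_diff_distrib) simp
    ultimately show ?thesis by simp
  qed
  then have "(\<lambda>m. \<Sum>i<m. (F (grid 0 t m (Suc i)) - F (grid 0 t m i)) * (B t - B (grid 0 t m (Suc i))))
      \<longlonglongrightarrow> R t - R 0"
  proof (intro stieltjes_sums_tendsto[where F' = "\<lambda>x. F x / \<epsilon>" and K = "1 / \<epsilon>"])
    show "continuous_on {0..t} (\<lambda>x. B t - B x)"
      using B by (intro continuous_intros) (auto intro: continuous_on_subset)
    show "\<bar>F x / \<epsilon>\<bar> \<le> 1 / \<epsilon>" if "x \<in> {0..t}" for x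
      using that assms(1) by (simp add: F_def divide_right_mono divide_nonpos_pos)
  qed (use assms dF in auto)
  then have "(\<lambda>m. F 0 * (B t - B 0) + (\<Sum>i<m. (F (grid 0 t m (Suc i)) - F (grid 0 t m i)) * (B t - B (grid 0 t m (Suc i)))))
      \<longlonglongrightarrow> F 0 * (B t - B 0) + (R t - R 0)"
    by (intro tendsto_intros)
  moreover have "F 0 * (B t - B 0) + (R t - R 0) = D t - exp (- t / \<epsilon>) * D 0"
    using eqV[of t] assms(2) by (simp add: R_def F_def V_def algebra_simps)
  ultimately show ?thesis
    by (simp add: kernel_weight_sum_eq F_def)
qed

section \<open>Fourth moments of Gaussian variables\<close>

lemma gaussian_rv_moments:
  assumes "prob_space M" "gaussian_rv M Z" "integral\<^sup>L M Z = 0"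
  shows "integrable M (\<lambda>\<omega>. Z \<omega> ^ 2)" "integrable M (\<lambda>\<omega>. Z \<omega> ^ 4)"
    "integral\<^sup>L M (\<lambda>\<omega>. Z \<omega> ^ 4) = 3 * (integral\<^sup>L M (\<lambda>\<omega>. Z \<omega> ^ 2))\<^sup>2"
proof -
  interpret prob_space M by fact
  have [measurable]: "Z \<in> borel_measurable M" using assms(2) by (simp add: gaussian_rv_def)
  consider m where "AE \<omega> in M. Z \<omega> = m" | m s where "0 < s" "distributed M lborel Z (normal_density m s)"
    using assms(2) by (auto simp: gaussian_rv_def)
  then have "integrable M (\<lambda>\<omega>. Z \<omega> ^ 2) \<and> integrable M (\<lambda>\<omega>. Z \<omega> ^ 4) \<and>
    integral\<^sup>L M (\<lambda>\<omega>. Z \<omega> ^ 4) = 3 * (integral\<^sup>L M (\<lambda>\<omega>. Z \<omega> ^ 2))\<^sup>2"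
  proof cases
    case 1
    have "integral\<^sup>L M Z = integral\<^sup>L M (\<lambda>\<omega>. m)"
      using 1 by (intro integral_cong_AE) auto
    then have "m = 0" using assms(3) by (simp add: prob_space)
    then have ae: "AE \<omega> in M. Z \<omega> ^ k = 0" if "0 < k" for k
      using 1 that by auto
    have int: "integrable M (\<lambda>\<omega>. Z \<omega> ^ k)" and zero: "integral\<^sup>L M (\<lambda>\<omega>. Z \<omega> ^ k) = 0" if "0 < k" for k
    proof -
      show "integrable M (\<lambda>\<omega>. Z \<omega> ^ k)"
        using integrable_cong_AE[of "\<lambda>\<omega>. Z \<omega> ^ k" M "\<lambda>_. 0"] ae[OF that] by simp
      show "integral\<^sup>L M (\<lambda>\<omega>. Z \<omega> ^ k) = 0"
        using integral_cong_AE[of "\<lambda>\<omega>. Z \<omega> ^ k" M "\<lambda>_. 0"] ae[OF that] by simp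
    qed
    show ?thesis by (simp add: int zero)
  next
    case 2
    have "m = 0" using normal_distributed_expectation[OF 2] assms(3) by simp
    have D: "distributed M lborel Z (normal_density 0 s)" using 2 \<open>m = 0\<close> by simp
    have int: "integrable M (\<lambda>\<omega>. Z \<omega> ^ k)" for k
      using distributed_integrable[OF D, of "\<lambda>x. x ^ k"] integrable_normal_moment[OF 2(1), of 0 k] by simp
    have mom: "integral\<^sup>L M (\<lambda>\<omega>. Z \<omega> ^ (2 * k)) = fact (2 * k) / ((2 / s\<^sup>2) ^ k * fact k)" for k
      using distributed_integral[OF D, of "\<lambda>x. x ^ (2 * k)"] integral_normal_moment_even[OF 2(1), of 0 k] by simp
    have "integral\<^sup>L M (\<lambda>\<omega>. Z \<omega> ^ 2) = s\<^sup>2" "integral\<^sup>L M (\<lambda>\<omega>. Z \<omega> ^ 4) = 3 * (s\<^sup>2)\<^sup>2"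
      using mom[of 1] mom[of 2] 2(1) by (simp_all add: fact_numeral power2_eq_square power4_eq_xxxx)
    then show ?thesis using int by simp
  qed
  then show "integrable M (\<lambda>\<omega>. Z \<omega> ^ 2)" "integrable M (\<lambda>\<omega>. Z \<omega> ^ 4)"
    "integral\<^sup>L M (\<lambda>\<omega>. Z \<omega> ^ 4) = 3 * (integral\<^sup>L M (\<lambda>\<omega>. Z \<omega> ^ 2))\<^sup>2" by auto
qed

text \<open>
  Linear spaces of centred Gaussian variables.  Joint normality is only ever used through linear
  combinations, so closure under these replaces any statement on joint densities.
\<close>
definition gaussian_space :: "'a measure \<Rightarrow> ('a \<Rightarrow> real) set \<Rightarrow> bool" where
  "gaussian_space M V \<longleftrightarrow>
     (\<forall>U\<in>V. gaussian_rv M U \<and> integral\<^sup>L M U = 0) \<and>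
     (\<forall>U\<in>V. \<forall>W\<in>V. (\<lambda>\<omega>. U \<omega> + W \<omega>) \<in> V) \<and>
     (\<forall>U\<in>V. \<forall>c. (\<lambda>\<omega>. c * U \<omega>) \<in> V)"

text \<open>
  Polarization: \<open>12 * U\<^sup>2 * W\<^sup>2 = (U + W)^4 + (U - W)^4 - 2 * U^4 - 2 * W^4\<close>, and the fourth moment of
  each of the four centred Gaussian variables is three times the square of its variance.
\<close>
lemma gaussian_space_products:
  assumes "prob_space M" "gaussian_space M V" "U \<in> V" "W \<in> V"
  shows "integrable M (\<lambda>\<omega>. U \<omega> * W \<omega>)" "integrable M (\<lambda>\<omega>. (U \<omega>)\<^sup>2 * (W \<omega>)\<^sup>2)"
    "integral\<^sup>L M (\<lambda>\<omega>. (U \<omega>)\<^sup>2 * (W \<omega>)\<^sup>2) =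
       integral\<^sup>L M (\<lambda>\<omega>. (U \<omega>)\<^sup>2) * integral\<^sup>L M (\<lambda>\<omega>. (W \<omega>)\<^sup>2) + 2 * (integral\<^sup>L M (\<lambda>\<omega>. U \<omega> * W \<omega>))\<^sup>2"
proof -
  interpret prob_space M by fact
  note mom = gaussian_rv_moments[OF assms(1)]
  define P where "P = (\<lambda>\<omega>. U \<omega> + W \<omega>)"
  define N where "N = (\<lambda>\<omega>. U \<omega> + (-1) * W \<omega>)"
  have in_V: "P \<in> V" "N \<in> V"
  proof -
    have add: "(\<lambda>\<omega>. Z \<omega> + Z' \<omega>) \<in> V" if "Z \<in> V" "Z' \<in> V" for Z Z'
      using that assms(2) by (auto simp: gaussian_space_def)
    have neg: "(\<lambda>\<omega>. (-1) * W \<omega>) \<in> V"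
      using assms(2,4) unfolding gaussian_space_def by blast
    show "P \<in> V" unfolding P_def by (rule add[OF assms(3,4)])
    show "N \<in> V" unfolding N_def by (rule add[OF assms(3) neg])
  qed
  have g: "gaussian_rv M Z \<and> integral\<^sup>L M Z = 0" if "Z \<in> V" for Z
    using that assms(2) by (auto simp: gaussian_space_def)
  have i2: "integrable M (\<lambda>\<omega>. Z \<omega> ^ 2)" and i4: "integrable M (\<lambda>\<omega>. Z \<omega> ^ 4)"
    and e4: "integral\<^sup>L M (\<lambda>\<omega>. Z \<omega> ^ 4) = 3 * (integral\<^sup>L M (\<lambda>\<omega>. Z \<omega> ^ 2))\<^sup>2" if "Z \<in> V" for Z
    using mom g[OF that] by auto
  have UW: "U \<omega> * W \<omega> = (P \<omega> ^ 2 - N \<omega> ^ 2) / 4" for \<omega>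
    by (simp add: P_def N_def power2_eq_square algebra_simps)
  show iUW: "integrable M (\<lambda>\<omega>. U \<omega> * W \<omega>)"
    unfolding UW using i2 in_V by auto
  have UW4: "(U \<omega>)\<^sup>2 * (W \<omega>)\<^sup>2 = (P \<omega> ^ 4 + N \<omega> ^ 4 - 2 * U \<omega> ^ 4 - 2 * W \<omega> ^ 4) / 12" for \<omega>
    by (simp add: P_def N_def power4_eq_xxxx power2_eq_square algebra_simps)
  show "integrable M (\<lambda>\<omega>. (U \<omega>)\<^sup>2 * (W \<omega>)\<^sup>2)"
    unfolding UW4 using i4 in_V assms(3,4) by auto
  define a b c where "a = integral\<^sup>L M (\<lambda>\<omega>. U \<omega> ^ 2)" and "b = integral\<^sup>L M (\<lambda>\<omega>. W \<omega> ^ 2)"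
    and "c = integral\<^sup>L M (\<lambda>\<omega>. U \<omega> * W \<omega>)"
  have sqP: "P \<omega> ^ 2 = U \<omega> ^ 2 + W \<omega> ^ 2 + 2 * (U \<omega> * W \<omega>)"
    and sqN: "N \<omega> ^ 2 = U \<omega> ^ 2 + W \<omega> ^ 2 - 2 * (U \<omega> * W \<omega>)" for \<omega>
    by (simp_all add: P_def N_def power2_eq_square algebra_simps)
  have P2: "integral\<^sup>L M (\<lambda>\<omega>. P \<omega> ^ 2) = a + b + 2 * c"
    and N2: "integral\<^sup>L M (\<lambda>\<omega>. N \<omega> ^ 2) = a + b - 2 * c"
    unfolding sqP sqN using i2 iUW assms(3,4) by (simp_all add: a_def b_def c_def)
  have "integral\<^sup>L M (\<lambda>\<omega>. (U \<omega>)\<^sup>2 * (W \<omega>)\<^sup>2)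
      = (3 * (a + b + 2 * c)\<^sup>2 + 3 * (a + b - 2 * c)\<^sup>2 - 2 * (3 * a\<^sup>2) - 2 * (3 * b\<^sup>2)) / 12"
    unfolding UW4 using i4 in_V assms(3,4) by (simp add: e4 P2 N2 flip: a_def b_def)
  also have "\<dots> = a * b + 2 * c\<^sup>2"
    by (simp add: power2_eq_square algebra_simps)
  finally show "integral\<^sup>L M (\<lambda>\<omega>. (U \<omega>)\<^sup>2 * (W \<omega>)\<^sup>2) =
       integral\<^sup>L M (\<lambda>\<omega>. (U \<omega>)\<^sup>2) * integral\<^sup>L M (\<lambda>\<omega>. (W \<omega>)\<^sup>2) + 2 * (integral\<^sup>L M (\<lambda>\<omega>. U \<omega> * W \<omega>))\<^sup>2"
    by (simp add: a_def b_def c_def)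
qed

lemma variance_sum_squares:
  assumes "prob_space M" "gaussian_space M V" "finite I" "\<And>k. k \<in> I \<Longrightarrow> U k \<in> V"
  shows "integrable M (\<lambda>\<omega>. (\<Sum>k\<in>I. (U k \<omega>)\<^sup>2 - integral\<^sup>L M (\<lambda>\<omega>. (U k \<omega>)\<^sup>2))\<^sup>2)"
    "integral\<^sup>L M (\<lambda>\<omega>. (\<Sum>k\<in>I. (U k \<omega>)\<^sup>2 - integral\<^sup>L M (\<lambda>\<omega>. (U k \<omega>)\<^sup>2))\<^sup>2)
       = 2 * (\<Sum>j\<in>I. \<Sum>k\<in>I. (integral\<^sup>L M (\<lambda>\<omega>. U j \<omega> * U k \<omega>))\<^sup>2)"
proof -
  interpret prob_space M by fact
  note prod = gaussian_space_products[OF assms(1,2)]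
  define q where "q k = integral\<^sup>L M (\<lambda>\<omega>. (U k \<omega>)\<^sup>2)" for k
  have i2: "integrable M (\<lambda>\<omega>. (U k \<omega>)\<^sup>2)" if "k \<in> I" for k
    using prod(1)[OF assms(4)[OF that] assms(4)[OF that]] by (simp add: power2_eq_square)
  have expand: "((U j \<omega>)\<^sup>2 - q j) * ((U k \<omega>)\<^sup>2 - q k)
     = (U j \<omega>)\<^sup>2 * (U k \<omega>)\<^sup>2 - q k * (U j \<omega>)\<^sup>2 - q j * (U k \<omega>)\<^sup>2 + q j * q k" for j k \<omega>
    by (simp add: algebra_simps)
  have int: "integrable M (\<lambda>\<omega>. ((U j \<omega>)\<^sup>2 - q j) * ((U k \<omega>)\<^sup>2 - q k))" if "j \<in> I" "k \<in> I" for j k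
    unfolding expand using that i2 prod(2) assms(4) by auto
  have cov: "integral\<^sup>L M (\<lambda>\<omega>. ((U j \<omega>)\<^sup>2 - q j) * ((U k \<omega>)\<^sup>2 - q k))
      = 2 * (integral\<^sup>L M (\<lambda>\<omega>. U j \<omega> * U k \<omega>))\<^sup>2" if "j \<in> I" "k \<in> I" for j k
    unfolding expand using that i2 prod(2,3) assms(4) by (simp add: q_def[symmetric] prob_space)
  have sq: "(\<Sum>k\<in>I. (U k \<omega>)\<^sup>2 - q k)\<^sup>2 = (\<Sum>j\<in>I. \<Sum>k\<in>I. ((U j \<omega>)\<^sup>2 - q j) * ((U k \<omega>)\<^sup>2 - q k))" for \<omega>
    by (simp only: power2_eq_square sum_product)
  show "integrable M (\<lambda>\<omega>. (\<Sum>k\<in>I. (U k \<omega>)\<^sup>2 - integral\<^sup>L M (\<lambda>\<omega>. (U k \<omega>)\<^sup>2))\<^sup>2)"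
    unfolding q_def[symmetric] sq using int by auto
  show "integral\<^sup>L M (\<lambda>\<omega>. (\<Sum>k\<in>I. (U k \<omega>)\<^sup>2 - integral\<^sup>L M (\<lambda>\<omega>. (U k \<omega>)\<^sup>2))\<^sup>2)
       = 2 * (\<Sum>j\<in>I. \<Sum>k\<in>I. (integral\<^sup>L M (\<lambda>\<omega>. U j \<omega> * U k \<omega>))\<^sup>2)"
    unfolding q_def[symmetric] sq using int by (simp add: cov sum_distrib_left)
qed

section \<open>Decay of the covariance of second differences\<close>

text \<open>
  Minus one half of the fourth central difference of \<open>\<bar>x\<bar> powr p\<close>.  For \<open>p = 2 * H\<close> it is the covariance of
  two second differences at unit step of fractional Brownian motion with lag \<open>x\<close>.
\<close>
definition second_diff_cov :: "real \<Rightarrow> real \<Rightarrow> real" where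
  "second_diff_cov p x = - (\<bar>x + 2\<bar> powr p - 4 * \<bar>x + 1\<bar> powr p + 6 * \<bar>x\<bar> powr p
                        - 4 * \<bar>x - 1\<bar> powr p + \<bar>x - 2\<bar> powr p) / 2"

lemma second_diff_cov_minus: "second_diff_cov p (- x) = second_diff_cov p x"
proof -
  have "\<bar>- x + 2\<bar> = \<bar>x - 2\<bar>" "\<bar>- x + 1\<bar> = \<bar>x - 1\<bar>" "\<bar>- x - 1\<bar> = \<bar>x + 1\<bar>" "\<bar>- x - 2\<bar> = \<bar>x + 2\<bar>" by auto
  then show ?thesis by (simp add: second_diff_cov_def algebra_simps)
qed

lemma second_diff_cov_0: "second_diff_cov p 0 = 4 - 2 powr p"
  by (simp add: second_diff_cov_def)

text \<open>
  Two applications of the mean value theorem bound the second difference by the second derivative,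
  which is of order \<open>x powr (p - 2)\<close>.
\<close>
lemma second_diff_powr_tendsto_0:
  fixes p :: real
  assumes "p < 2"
  shows "((\<lambda>x. (x + 1) powr p - 2 * x powr p + (x - 1) powr p) \<longlongrightarrow> 0) at_top"
proof (rule Lim_null_comparison)
  show "((\<lambda>x. \<bar>p * (p - 1)\<bar> * (x - 1) powr (p - 2)) \<longlongrightarrow> 0) at_top"
    using assms by real_asymp
  show "\<forall>\<^sub>F x in at_top. norm ((x + 1) powr p - 2 * x powr p + (x - 1) powr p)
      \<le> \<bar>p * (p - 1)\<bar> * (x - 1) powr (p - 2)"
    using eventually_gt_at_top[of 1]
  proof eventually_elim
    case (elim x)
    have powr_deriv: "((\<lambda>y. y powr r) has_real_derivative r * y powr (r - 1)) (at y)" if "0 < y" for r y :: real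
      using that by (auto intro!: derivative_eq_intros)
    define g where "g y = (y + 1) powr p - y powr p" for y
    have "\<exists>z>x - 1. z < x \<and> g x - g (x - 1) = (x - (x - 1)) * (p * (z + 1) powr (p - 1) - p * z powr (p - 1))"
      unfolding g_def using elim
      by (intro MVT2 DERIV_diff powr_deriv DERIV_shift[THEN iffD1]) (auto simp: add.commute)
    then obtain z where z: "x - 1 < z" "z < x"
      and gz: "g x - g (x - 1) = p * ((z + 1) powr (p - 1) - z powr (p - 1))"
      by (auto simp: algebra_simps)
    have "\<exists>w>z. w < z + 1 \<and> (z + 1) powr (p - 1) - z powr (p - 1) = (z + 1 - z) * ((p - 1) * w powr (p - 1 - 1))"
      using z elim by (intro MVT2 powr_deriv) auto
    then obtain w where w: "z < w" "(z + 1) powr (p - 1) - z powr (p - 1) = (p - 1) * w powr (p - 2)"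
      by (auto simp: algebra_simps)
    have "g x - g (x - 1) = p * (p - 1) * w powr (p - 2)" using gz w by simp
    moreover have "w powr (p - 2) \<le> (x - 1) powr (p - 2)"
      using w z elim assms by (intro powr_mono2') auto
    ultimately have "\<bar>g x - g (x - 1)\<bar> \<le> \<bar>p * (p - 1)\<bar> * (x - 1) powr (p - 2)"
      by (simp only: abs_mult) (simp add: mult_left_mono)
    moreover have "g x - g (x - 1) = (x + 1) powr p - 2 * x powr p + (x - 1) powr p"
      by (simp add: g_def)
    ultimately show ?case by simp
  qed
qed

lemma cesaro_tendsto_0:
  fixes a :: "nat \<Rightarrow> real"
  assumes "a \<longlonglongrightarrow> 0"
  shows "(\<lambda>n. (\<Sum>m<n. a m) / real n) \<longlonglongrightarrow> 0"
proof (rule LIMSEQ_I)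
  fix e :: real assume "0 < e"
  then obtain N where N: "\<And>m. N \<le> m \<Longrightarrow> \<bar>a m\<bar> < e / 2"
    using LIMSEQ_D[OF assms, of "e / 2"] by auto
  define S where "S = (\<Sum>m<N. \<bar>a m\<bar>)"
  obtain K :: nat where K: "2 * S / e < real K" using reals_Archimedean2 by blast
  show "\<exists>no. \<forall>n\<ge>no. norm ((\<Sum>m<n. a m) / real n - 0) < e"
  proof (intro exI[of _ "Suc (max N K)"] allI impI)
    fix n assume n: "Suc (max N K) \<le> n"
    have "\<bar>\<Sum>m<n. a m\<bar> \<le> (\<Sum>m<n. \<bar>a m\<bar>)" by (rule sum_abs)
    also have "(\<Sum>m<n. \<bar>a m\<bar>) = S + (\<Sum>m=N..<n. \<bar>a m\<bar>)"
    proof -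
      have "{..<n} = {..<N} \<union> {N..<n}" using n by auto
      moreover have "(\<Sum>m\<in>{..<N} \<union> {N..<n}. \<bar>a m\<bar>) = S + (\<Sum>m=N..<n. \<bar>a m\<bar>)"
        unfolding S_def by (rule sum.union_disjoint) auto
      ultimately show ?thesis by (simp only:)
    qed
    also have "\<dots> \<le> S + (\<Sum>m=N..<n. e / 2)"
      using N by (intro add_left_mono sum_mono less_imp_le) auto
    also have "\<dots> \<le> S + real n * (e / 2)"
      using \<open>0 < e\<close> by (simp add: mult_right_mono)
    also have "S < real n * (e / 2)"
    proof -
      have "real K < real n" using n by simp
      then have "2 * S / e < real n" using K by linarith
      then show ?thesis using \<open>0 < e\<close> by (simp add: field_simps)
    qed
    finally have "\<bar>\<Sum>m<n. a m\<bar> < real n * e" by (simp add: mult.commute)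
    then show "norm ((\<Sum>m<n. a m) / real n - 0) < e"
      using n by (simp add: pos_divide_less_eq mult.commute)
  qed
qed

text \<open>
  The fourth difference is a combination of three second differences, each of which already vanishes
  in the limit.  This
  is what the Cesaro means of the squares in the variance call for.
\<close>
lemma second_diff_cov_tendsto_0:
  assumes "p < 2"
  shows "(\<lambda>m. second_diff_cov p (real m)) \<longlonglongrightarrow> 0"
proof -
  define D where "D x = (x + 1) powr p - 2 * x powr p + (x - 1) powr p" for x :: real
  have D: "(D \<longlongrightarrow> 0) at_top"
    unfolding D_def by (rule second_diff_powr_tendsto_0[OF assms])
  have lim: "(\<lambda>m. D (real m + c)) \<longlonglongrightarrow> 0" for c
    by (rule filterlim_compose[OF D]) real_asymp
  have "(\<lambda>m. - (D (real m + 1) - 2 * D (real m + 0) + D (real m + (-1))) / 2) \<longlonglongrightarrow> - (0 - 2 * 0 + 0) / 2"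
    by (intro tendsto_intros lim) auto
  moreover have "\<forall>\<^sub>F m in sequentially. - (D (real m + 1) - 2 * D (real m + 0) + D (real m + (-1))) / 2
      = second_diff_cov p (real m)"
    using eventually_ge_at_top[of 2]
  proof eventually_elim
    case (elim m)
    then have "2 \<le> real m" by simp
    moreover have "real m + - 1 + 1 = real m" "real m + 1 - 1 = real m" "real m + 1 + 1 = real m + 2"
       "real m + - 1 - 1 = real m - 2" "real m + - 1 = real m - 1" by auto
    ultimately show ?case unfolding D_def second_diff_cov_def by (simp add: field_simps)
  qed
  ultimately have "(\<lambda>m. second_diff_cov p (real m)) \<longlonglongrightarrow> - (0 - 2 * 0 + 0) / 2"
    by (rule Lim_transform_eventually)
  then show ?thesis by simp
qed

text \<open>
  Every lag \<open>m < n\<close> occurs at most twice in each row, once on either side of the diagonal.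
\<close>
lemma sum_double_even_le:
  fixes f :: "real \<Rightarrow> real"
  assumes "\<And>x. 0 \<le> f x" "\<And>x. f (- x) = f x"
  shows "(\<Sum>j=2..n. \<Sum>k=2..n. f (real j - real k)) \<le> 2 * real n * (\<Sum>m<n. f (real m))"
proof -
  have "(\<Sum>k=2..n. f (real j - real k)) \<le> 2 * (\<Sum>m<n. f (real m))" if j: "j \<in> {2..n}" for j
  proof -
    have "(\<Sum>k=2..n. f (real j - real k)) = (\<Sum>k\<in>{2..j}. f (real j - real k)) + (\<Sum>k\<in>{j<..n}. f (real j - real k))"
    proof -
      have "{2..n} = {2..j} \<union> {j<..n}" using j by auto
      moreover have "(\<Sum>k\<in>{2..j} \<union> {j<..n}. f (real j - real k))
          = (\<Sum>k\<in>{2..j}. f (real j - real k)) + (\<Sum>k\<in>{j<..n}. f (real j - real k))"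
        by (rule sum.union_disjoint) auto
      ultimately show ?thesis by (simp only:)
    qed
    also have "(\<Sum>k\<in>{2..j}. f (real j - real k)) = (\<Sum>m\<in>(\<lambda>k. j - k) ` {2..j}. f (real m))"
      by (subst sum.reindex) (auto simp: inj_on_def of_nat_diff)
    also have "\<dots> \<le> (\<Sum>m<n. f (real m))"
      using j assms(1) by (intro sum_mono2) auto
    also have "(\<Sum>k\<in>{j<..n}. f (real j - real k)) = (\<Sum>k\<in>{j<..n}. f (real (k - j)))"
    proof (rule sum.cong)
      fix k assume "k \<in> {j<..n}"
      then have "real j - real k = - real (k - j)" by (simp add: of_nat_diff)
      then show "f (real j - real k) = f (real (k - j))" by (simp only: assms(2))
    qed simp
    also have "\<dots> = (\<Sum>m\<in>(\<lambda>k. k - j) ` {j<..n}. f (real m))"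
      by (subst sum.reindex) (auto simp: inj_on_def)
    also have "\<dots> \<le> (\<Sum>m<n. f (real m))"
      using j assms(1) by (intro sum_mono2) auto
    finally show ?thesis by simp
  qed
  then have "(\<Sum>j=2..n. \<Sum>k=2..n. f (real j - real k)) \<le> (\<Sum>j=2..n. 2 * (\<Sum>m<n. f (real m)))"
    by (intro sum_mono)
  also have "\<dots> \<le> 2 * real n * (\<Sum>m<n. f (real m))"
    using assms(1) by (auto intro!: mult_right_mono sum_nonneg)
  finally show ?thesis .
qed

section \<open>Linear combinations of fractional Brownian motion\<close>

locale fBm = prob_space M for M :: "'a measure" +
  fixes H :: real and B :: "real \<Rightarrow> 'a \<Rightarrow> real"
  assumes fBm: "fractional_brownian_motion M H B" and H_pos: "0 < H" and H_less_1: "H < 1"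
begin

definition B_span :: "('a \<Rightarrow> real) set" where
  "B_span = {Z. \<exists>J c. finite J \<and> Z = (\<lambda>\<omega>. \<Sum>t\<in>J. c t * B t \<omega>)}"

lemma B_in_span: "B t \<in> B_span"
  unfolding B_span_def by (intro CollectI exI[of _ "{t}"] exI[of _ "\<lambda>_. 1"]) auto

lemma span_scale: "U \<in> B_span \<Longrightarrow> (\<lambda>\<omega>. c * U \<omega>) \<in> B_span"
  unfolding B_span_def
proof safe
  fix J :: "real set" and d :: "real \<Rightarrow> real" assume "finite J"
  then show "\<exists>J' c'. finite J' \<and> (\<lambda>\<omega>. c * (\<Sum>t\<in>J. d t * B t \<omega>)) = (\<lambda>\<omega>. \<Sum>t\<in>J'. c' t * B t \<omega>)"
    by (intro exI[of _ J] exI[of _ "\<lambda>t. c * d t"]) (auto simp: sum_distrib_left mult.assoc)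
qed

lemma span_add: "U \<in> B_span \<Longrightarrow> W \<in> B_span \<Longrightarrow> (\<lambda>\<omega>. U \<omega> + W \<omega>) \<in> B_span"
  unfolding B_span_def
proof safe
  fix J J' :: "real set" and c c' :: "real \<Rightarrow> real" assume J: "finite J" "finite J'"
  have ext: "(\<Sum>t\<in>I. d t * B t \<omega>) = (\<Sum>t\<in>J \<union> J'. (if t \<in> I then d t else 0) * B t \<omega>)"
    if "I \<subseteq> J \<union> J'" for I d \<omega>
    using that J by (intro sum.mono_neutral_cong_left) auto
  show "\<exists>K d. finite K \<and> (\<lambda>\<omega>. (\<Sum>t\<in>J. c t * B t \<omega>) + (\<Sum>t\<in>J'. c' t * B t \<omega>)) = (\<lambda>\<omega>. \<Sum>t\<in>K. d t * B t \<omega>)"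
    using J ext[of J c] ext[of J' c']
    by (intro exI[of _ "J \<union> J'"] exI[of _ "\<lambda>t. (if t \<in> J then c t else 0) + (if t \<in> J' then c' t else 0)"])
       (auto simp: sum.distrib distrib_right)
qed

lemma gaussian_span: "U \<in> B_span \<Longrightarrow> gaussian_rv M U"
  using fBm by (auto simp: B_span_def fractional_brownian_motion_def gaussian_process_def)

lemma B_measurable [measurable]: "B t \<in> borel_measurable M"
  using gaussian_span[OF B_in_span] by (simp add: gaussian_rv_def)

lemma B_mean: "integral\<^sup>L M (B t) = 0"
  using fBm by (simp add: fractional_brownian_motion_def)

lemma B_integrable: "integrable M (B t)"
  by (rule square_integrable_imp_integrable[OF B_measurable
        gaussian_rv_moments(1)[OF prob_space_axioms gaussian_span[OF B_in_span] B_mean]])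

lemma gaussian_space_span: "gaussian_space M B_span"
  unfolding gaussian_space_def
proof (intro conjI ballI allI)
  fix U assume U: "U \<in> B_span"
  show "gaussian_rv M U" by (rule gaussian_span[OF U])
  show "(\<lambda>\<omega>. c * U \<omega>) \<in> B_span" for c by (rule span_scale[OF U])
  show "(\<lambda>\<omega>. U \<omega> + W \<omega>) \<in> B_span" if "W \<in> B_span" for W by (rule span_add[OF U that])
  obtain J c where U_eq: "U = (\<lambda>\<omega>. \<Sum>t\<in>J. c t * B t \<omega>)" using U unfolding B_span_def by blast
  show "integral\<^sup>L M U = 0" unfolding U_eq by (simp add: B_integrable B_mean)
qed

lemma B_product_integrable: "integrable M (\<lambda>\<omega>. B t \<omega> * B s \<omega>)"
  by (rule gaussian_space_products(1)[OF prob_space_axioms gaussian_space_span B_in_span B_in_span])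

lemma B_cov: "integral\<^sup>L M (\<lambda>\<omega>. B t \<omega> * B s \<omega>)
    = 1 / 2 * (\<bar>t\<bar> powr (2 * H) + \<bar>s\<bar> powr (2 * H) - \<bar>t - s\<bar> powr (2 * H))"
  using fBm by (simp add: fractional_brownian_motion_def)

lemma increment_variance:
  "integrable M (\<lambda>\<omega>. (B t \<omega> - B s \<omega>)\<^sup>2)"
  "integral\<^sup>L M (\<lambda>\<omega>. (B t \<omega> - B s \<omega>)\<^sup>2) = \<bar>t - s\<bar> powr (2 * H)"
proof -
  have sq: "(B t \<omega> - B s \<omega>)\<^sup>2 = B t \<omega> * B t \<omega> - 2 * (B t \<omega> * B s \<omega>) + B s \<omega> * B s \<omega>" for \<omega>
    by (simp add: power2_eq_square algebra_simps)
  show "integrable M (\<lambda>\<omega>. (B t \<omega> - B s \<omega>)\<^sup>2)"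
    unfolding sq by (simp add: B_product_integrable)
  show "integral\<^sup>L M (\<lambda>\<omega>. (B t \<omega> - B s \<omega>)\<^sup>2) = \<bar>t - s\<bar> powr (2 * H)"
    unfolding sq by (simp add: B_product_integrable B_cov) (simp add: field_simps)
qed

lemma second_diff_in_span: "(\<lambda>\<omega>. second_diff (\<lambda>t. B t \<omega>) d k) \<in> B_span"
proof -
  have "(\<lambda>\<omega>. (B (real k * d) \<omega> + (-2) * B ((real k - 1) * d) \<omega>) + B ((real k - 2) * d) \<omega>) \<in> B_span"
    by (intro span_add span_scale B_in_span)
  then show ?thesis by (simp add: second_diff_def)
qed

text \<open>
  The two coefficient sequences \<open>1, -2, 1\<close> sum to \<open>0\<close>, so the terms of the covariance that depend on one
  of the times alone cancel.  Only the term in the time difference survives, and there the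
  convolution of the coefficients is the fourth difference.
\<close>
lemma second_diff_covariance:
  assumes "0 < d"
  shows "integral\<^sup>L M (\<lambda>\<omega>. second_diff (\<lambda>t. B t \<omega>) d j * second_diff (\<lambda>t. B t \<omega>) d k)
     = d powr (2 * H) * second_diff_cov (2 * H) (real j - real k)"
proof -
  define x where "x = real j - real k"
  define \<phi> where "\<phi> y = \<bar>y\<bar> powr (2 * H)" for y :: real
  have expand: "second_diff (\<lambda>t. B t \<omega>) d j * second_diff (\<lambda>t. B t \<omega>) d k =
      B (real j * d) \<omega> * B (real k * d) \<omega> - 2 * (B (real j * d) \<omega> * B ((real k - 1) * d) \<omega>)
      + B (real j * d) \<omega> * B ((real k - 2) * d) \<omega>
      - 2 * (B ((real j - 1) * d) \<omega> * B (real k * d) \<omega>) + 4 * (B ((real j - 1) * d) \<omega> * B ((real k - 1) * d) \<omega>)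
      - 2 * (B ((real j - 1) * d) \<omega> * B ((real k - 2) * d) \<omega>)
      + B ((real j - 2) * d) \<omega> * B (real k * d) \<omega> - 2 * (B ((real j - 2) * d) \<omega> * B ((real k - 1) * d) \<omega>)
      + B ((real j - 2) * d) \<omega> * B ((real k - 2) * d) \<omega>" for \<omega>
    by (simp only: second_diff_def) (simp add: algebra_simps)
  have cov: "integral\<^sup>L M (\<lambda>\<omega>. B (u * d) \<omega> * B (v * d) \<omega>) = 1 / 2 * (\<phi> (u * d) + \<phi> (v * d) - d powr (2 * H) * \<phi> (u - v))"
    for u v
  proof -
    have "u * d - v * d = d * (u - v)" by (simp add: algebra_simps)
    then have "\<bar>u * d - v * d\<bar> = d * \<bar>u - v\<bar>"
      using assms by (simp add: abs_mult)
    then have "\<bar>u * d - v * d\<bar> powr (2 * H) = d powr (2 * H) * \<bar>u - v\<bar> powr (2 * H)"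
      using assms by (simp add: powr_mult)
    then show ?thesis by (simp add: B_cov \<phi>_def)
  qed
  have diffs: "real j - (real k - 1) = x + 1" "real j - (real k - 2) = x + 2" "real j - 1 - real k = x - 1"
    "real j - 1 - (real k - 1) = x" "real j - 1 - (real k - 2) = x + 1" "real j - 2 - real k = x - 2"
    "real j - 2 - (real k - 1) = x - 1" "real j - 2 - (real k - 2) = x" "real j - real k = x"
    by (auto simp: x_def)
  have "integral\<^sup>L M (\<lambda>\<omega>. second_diff (\<lambda>t. B t \<omega>) d j * second_diff (\<lambda>t. B t \<omega>) d k)
     = d powr (2 * H) * (- (\<phi> (x + 2) - 4 * \<phi> (x + 1) + 6 * \<phi> x - 4 * \<phi> (x - 1) + \<phi> (x - 2)) / 2)"
  proof -
    define K where "K u v = integral\<^sup>L M (\<lambda>\<omega>. B (u * d) \<omega> * B (v * d) \<omega>)" for u v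
    have "integral\<^sup>L M (\<lambda>\<omega>. second_diff (\<lambda>t. B t \<omega>) d j * second_diff (\<lambda>t. B t \<omega>) d k)
      = K (real j) (real k) - 2 * K (real j) (real k - 1) + K (real j) (real k - 2)
        - 2 * K (real j - 1) (real k) + 4 * K (real j - 1) (real k - 1) - 2 * K (real j - 1) (real k - 2)
        + K (real j - 2) (real k) - 2 * K (real j - 2) (real k - 1) + K (real j - 2) (real k - 2)"
      unfolding expand by (simp add: B_product_integrable K_def)
    also have "\<dots> = d powr (2 * H) * (- (\<phi> (x + 2) - 4 * \<phi> (x + 1) + 6 * \<phi> x - 4 * \<phi> (x - 1) + \<phi> (x - 2)) / 2)"
      unfolding K_def cov diffs by (simp add: algebra_simps)
    finally show ?thesis .
  qed
  then show ?thesis by (simp add: second_diff_cov_def \<phi>_def flip: x_def)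
qed

text \<open>
  The weights have total mass \<open>1\<close> because the last node is \<open>b\<close>, so the square of the average is at most
  the average of the squares, whose expectations are \<open>\<bar>b - s i\<bar> powr (2 * H)\<close>.
\<close>
lemma kernel_average_second_moment:
  assumes "0 < \<epsilon>" "mono s" "s m = b"
  shows "(\<integral>\<^sup>+\<omega>. ennreal ((\<Sum>i\<le>m. kernel_weight \<epsilon> b s i * (B b \<omega> - B (s i) \<omega>))\<^sup>2) \<partial>M)
           \<le> ennreal (3 * \<epsilon> powr (2 * H))"
proof -
  let ?w = "kernel_weight \<epsilon> b s"
  have w: "0 \<le> ?w i" for i by (rule kernel_weight_nonneg[OF assms(1,2)])
  have int: "integrable M (\<lambda>\<omega>. \<Sum>i\<le>m. ?w i * (B b \<omega> - B (s i) \<omega>)\<^sup>2)"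
    by (simp add: increment_variance)
  have "(\<integral>\<^sup>+\<omega>. ennreal ((\<Sum>i\<le>m. ?w i * (B b \<omega> - B (s i) \<omega>))\<^sup>2) \<partial>M)
      \<le> (\<integral>\<^sup>+\<omega>. ennreal (\<Sum>i\<le>m. ?w i * (B b \<omega> - B (s i) \<omega>)\<^sup>2) \<partial>M)"
    using assms(3) by (intro nn_integral_mono ennreal_leI square_weighted_sum_le w) (simp add: sum_kernel_weight)
  also have "\<dots> = ennreal (\<Sum>i\<le>m. ?w i * \<bar>b - s i\<bar> powr (2 * H))"
    using w by (subst nn_integral_eq_integral[OF int]) (auto intro!: sum_nonneg simp: increment_variance)
  also have "\<dots> \<le> ennreal (3 * \<epsilon> powr (2 * H))"
    using assms H_pos H_less_1 by (intro ennreal_leI kernel_weight_moment) auto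
  finally show ?thesis .
qed

end

section \<open>The stationary error term\<close>

text \<open>
  Fatou's lemma for squares: the bounds obtained for finite sums of increments survive the passage to
  the integrals against \<open>dB\<close>.
\<close>
lemma nn_integral_square_limit_le:
  fixes S :: "nat \<Rightarrow> 'a \<Rightarrow> real"
  assumes [measurable]: "\<And>m. S m \<in> borel_measurable M"
    and "AE \<omega> in M. (\<lambda>m. S m \<omega>) \<longlonglongrightarrow> Z \<omega>"
    and "\<forall>\<^sub>F m in sequentially. (\<integral>\<^sup>+\<omega>. ennreal ((S m \<omega>)\<^sup>2) \<partial>M) \<le> K"
  shows "(\<integral>\<^sup>+\<omega>. ennreal ((Z \<omega>)\<^sup>2) \<partial>M) \<le> K"
proof -
  have "AE \<omega> in M. ennreal ((Z \<omega>)\<^sup>2) = liminf (\<lambda>m. ennreal ((S m \<omega>)\<^sup>2))"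
    using assms(2)
  proof eventually_elim
    case (elim \<omega>)
    then have "(\<lambda>m. ennreal ((S m \<omega>)\<^sup>2)) \<longlonglongrightarrow> ennreal ((Z \<omega>)\<^sup>2)"
      by (intro tendsto_intros)
    then show ?case by (rule lim_imp_Liminf[OF sequentially_bot, symmetric])
  qed
  then have "(\<integral>\<^sup>+\<omega>. ennreal ((Z \<omega>)\<^sup>2) \<partial>M) = (\<integral>\<^sup>+\<omega>. liminf (\<lambda>m. ennreal ((S m \<omega>)\<^sup>2)) \<partial>M)"
    by (rule nn_integral_cong_AE)
  also have "\<dots> \<le> liminf (\<lambda>m. \<integral>\<^sup>+\<omega>. ennreal ((S m \<omega>)\<^sup>2) \<partial>M)"
    by (rule nn_integral_liminf) simp
  also have "\<dots> \<le> liminf (\<lambda>m. K)"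
    by (rule Liminf_mono[OF assms(3)])
  also have "\<dots> = K" by (simp add: Liminf_const)
  finally show ?thesis .
qed
text \<open>
  The velocity, rescaled to be the integral of \<open>exp (-(t - s) / \<epsilon>)\<close> against \<open>dB\<close> over \<open>(-\<infinity>, t]\<close>.
\<close>
definition kernel_integral :: "real \<Rightarrow> real \<Rightarrow> real \<Rightarrow> (real \<Rightarrow> 'a \<Rightarrow> real) \<Rightarrow> real \<Rightarrow> 'a \<Rightarrow> real" where
  "kernel_integral H \<epsilon> \<sigma>2 Y t \<omega> = \<epsilon> powr H * Y t \<omega> / \<sigma>2"

context fBm
begin

context
  fixes \<epsilon> \<sigma>1 \<sigma>2 x0 :: real and X Y :: "real \<Rightarrow> 'a \<Rightarrow> real"
  assumes kin: "kinetic_fBm M B H \<sigma>1 \<sigma>2 x0 \<epsilon> X Y" and eps: "0 < \<epsilon>" and sigma2: "\<sigma>2 \<noteq> 0"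
begin

abbreviation D :: "real \<Rightarrow> 'a \<Rightarrow> real" where
  "D \<equiv> kernel_integral H \<epsilon> \<sigma>2 Y"

lemma X_measurable: "0 \<le> t \<Longrightarrow> X t \<in> borel_measurable M"
  using kin[unfolded kinetic_fBm_def, THEN conjunct1] by blast

lemma D_measurable:
  assumes "0 \<le> t"
  shows "D t \<in> borel_measurable M"
proof -
  have [measurable]: "Y t \<in> borel_measurable M"
    using kin[unfolded kinetic_fBm_def, THEN conjunct1] assms by blast
  show ?thesis unfolding kernel_integral_def[abs_def] by measurable
qed

text \<open>
  The second equation expresses the time integral of \<open>Y\<close> by the increments of \<open>Y\<close> and \<open>B\<close>; inserting
  this into the first one leaves no integral.
\<close>
lemma AE_X_eq:
  "AE \<omega> in M. \<forall>t\<ge>0. X t \<omega> = x0 + \<sigma>1 * \<sigma>2 * ((B t \<omega> - B 0 \<omega>) - (D t \<omega> - D 0 \<omega>))"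
proof -
  from kin[unfolded kinetic_fBm_def, THEN conjunct2] show ?thesis
  proof eventually_elim
    case (elim \<omega>)
    show ?case
    proof (intro allI impI)
      fix t :: real assume t: "0 \<le> t"
      have Y_eq: "Y t \<omega> = Y 0 \<omega> + integral {0..t} (\<lambda>s. - (1 / \<epsilon>) * Y s \<omega>)
                        + \<sigma>2 / \<epsilon> powr H * (B t \<omega> - B 0 \<omega>)"
        and X_eq: "X t \<omega> = x0 + integral {0..t} (\<lambda>s. \<sigma>1 * \<epsilon> powr (H - 1) * Y s \<omega>)"
        using elim t by blast+
      define I where "I = integral {0..t} (\<lambda>s. Y s \<omega>)"
      have mult: "integral {0..t} (\<lambda>s. c * Y s \<omega>) = c * I" for c
        unfolding I_def by (rule integral_mult_right)
      have "Y t \<omega> = Y 0 \<omega> - I / \<epsilon> + \<sigma>2 / \<epsilon> powr H * (B t \<omega> - B 0 \<omega>)"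
        using Y_eq by (simp only: mult) simp
      then have I: "I = \<epsilon> * (Y 0 \<omega> - Y t \<omega> + \<sigma>2 / \<epsilon> powr H * (B t \<omega> - B 0 \<omega>))"
        using eps by (simp add: field_simps)
      have "X t \<omega> = x0 + \<sigma>1 * \<epsilon> powr (H - 1) * I"
        using X_eq by (simp only: mult)
      also have "\<epsilon> powr (H - 1) = \<epsilon> powr H / \<epsilon>"
        using eps by (simp add: powr_diff)
      finally show "X t \<omega> = x0 + \<sigma>1 * \<sigma>2 * ((B t \<omega> - B 0 \<omega>) - (D t \<omega> - D 0 \<omega>))"
        using eps sigma2 unfolding I kernel_integral_def
        by (simp add: diff_divide_distrib distrib_left right_diff_distrib)
    qed
  qed
qed

lemma AE_D_facts:
  "AE \<omega> in M. continuous_on UNIV (\<lambda>t. B t \<omega>) \<and> continuous_on {0..} (\<lambda>t. D t \<omega>) \<and>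
     has_RS_integral_atMost (\<lambda>s. exp (s / \<epsilon>)) (\<lambda>s. B s \<omega>) 0 (D 0 \<omega>) \<and>
     (\<forall>t\<ge>0. D t \<omega> = D 0 \<omega> + integral {0..t} (\<lambda>s. - (1 / \<epsilon>) * D s \<omega>) + (B t \<omega> - B 0 \<omega>))"
proof -
  have "AE \<omega> in M. continuous_on UNIV (\<lambda>t. B t \<omega>)"
    using fBm by (simp add: fractional_brownian_motion_def)
  from this kin[unfolded kinetic_fBm_def, THEN conjunct2] show ?thesis
  proof eventually_elim
    case (elim \<omega>)
    have eqD: "D t \<omega> = (\<epsilon> powr H / \<sigma>2) * Y t \<omega>" for t by (simp add: kernel_integral_def)
    have Y_eq: "Y t \<omega> = Y 0 \<omega> + integral {0..t} (\<lambda>s. - (1 / \<epsilon>) * Y s \<omega>)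
                      + \<sigma>2 / \<epsilon> powr H * (B t \<omega> - B 0 \<omega>)" if "0 \<le> t" for t
      using elim(2) that by blast
    have contY: "continuous_on {0..} (\<lambda>t. Y t \<omega>)" using elim(2) by blast
    from elim(2) obtain I where "has_RS_integral_atMost (\<lambda>s. exp (s / \<epsilon>)) (\<lambda>s. B s \<omega>) 0 I"
      "Y 0 \<omega> = \<epsilon> powr (- H) * \<sigma>2 * I" by blast
    then have "has_RS_integral_atMost (\<lambda>s. exp (s / \<epsilon>)) (\<lambda>s. B s \<omega>) 0 (D 0 \<omega>)"
      using eps sigma2 by (simp add: kernel_integral_def powr_minus flip: mult.assoc)
    moreover have "continuous_on {0..} (\<lambda>t. D t \<omega>)"
      unfolding eqD by (intro continuous_intros contY)
    moreover have "D t \<omega> = D 0 \<omega> + integral {0..t} (\<lambda>s. - (1 / \<epsilon>) * D s \<omega>) + (B t \<omega> - B 0 \<omega>)"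
      if "0 \<le> t" for t
    proof -
      have "integral {0..t} (\<lambda>s. - (1 / \<epsilon>) * D s \<omega>) = integral {0..t} (\<lambda>s. (\<epsilon> powr H / \<sigma>2) * (- (1 / \<epsilon>) * Y s \<omega>))"
        by (simp add: eqD mult.left_commute)
      also have "\<dots> = (\<epsilon> powr H / \<sigma>2) * integral {0..t} (\<lambda>s. - (1 / \<epsilon>) * Y s \<omega>)"
        by (rule integral_mult_right)
      also have "integral {0..t} (\<lambda>s. - (1 / \<epsilon>) * Y s \<omega>) = Y t \<omega> - Y 0 \<omega> - \<sigma>2 / \<epsilon> powr H * (B t \<omega> - B 0 \<omega>)"
        using Y_eq[OF that] by simp
      finally show ?thesis
        using eps sigma2 by (simp add: eqD right_diff_distrib)
    qed
    ultimately show ?case using elim(1) by blast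
  qed
qed

text \<open>
  Two limits are taken, one in the mesh of the partition and one in the left end point of the
  interval, and Fatou's lemma is applied to each.  The integrals over bounded intervals are only given
  path by path, so the measurable version \<open>J\<close> is built from the sums.
\<close>
lemma nn_integral_D_0:
  "(\<integral>\<^sup>+\<omega>. ennreal ((D 0 \<omega>)\<^sup>2) \<partial>M) \<le> ennreal (3 * \<epsilon> powr (2 * H))"
proof -
  define S where "S a m \<omega> = (\<Sum>i\<le>m. kernel_weight \<epsilon> 0 (grid a 0 m) i * (B 0 \<omega> - B (grid a 0 m i) \<omega>))" for a m \<omega>
  have [measurable]: "S a m \<in> borel_measurable M" for a m
    unfolding S_def by measurable
  define J where "J k \<omega> = lim (\<lambda>m. S (- real (Suc k)) m \<omega>)" for k \<omega>
  have [measurable]: "J k \<in> borel_measurable M" for k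
    unfolding J_def by measurable
  have lims: "AE \<omega> in M. (\<forall>k. (\<lambda>m. S (- real (Suc k)) m \<omega>) \<longlonglongrightarrow> J k \<omega>) \<and> (\<lambda>k. J k \<omega>) \<longlonglongrightarrow> D 0 \<omega>"
    using AE_D_facts
  proof eventually_elim
    case (elim \<omega>)
    then have "has_RS_integral_atMost (\<lambda>s. exp (s / \<epsilon>)) (\<lambda>s. B s \<omega>) 0 (D 0 \<omega>)" by blast
    then obtain I where I: "\<And>a. a \<le> 0 \<Longrightarrow> has_RS_integral (\<lambda>s. exp (s / \<epsilon>)) (\<lambda>s. B s \<omega>) a 0 (I a)"
      and lim: "(I \<longlongrightarrow> D 0 \<omega>) at_bot"
      by (auto simp: has_RS_integral_atMost_def)
    have S: "(\<lambda>m. S (- real (Suc k)) m \<omega>) \<longlonglongrightarrow> I (- real (Suc k))" for k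
      unfolding S_def by (rule RS_exp_integral_limit[OF I]) auto
    then have "J k \<omega> = I (- real (Suc k))" for k
      unfolding J_def by (rule limI)
    moreover have "(\<lambda>k. I (- real (Suc k))) \<longlonglongrightarrow> D 0 \<omega>"
      by (rule filterlim_compose[OF lim]) real_asymp
    ultimately show ?case using S by simp
  qed
  have lim_S: "AE \<omega> in M. (\<lambda>m. S (- real (Suc k)) m \<omega>) \<longlonglongrightarrow> J k \<omega>" for k
    by (rule eventually_mono[OF lims]) blast
  have lim_J: "AE \<omega> in M. (\<lambda>k. J k \<omega>) \<longlonglongrightarrow> D 0 \<omega>"
    by (rule eventually_mono[OF lims]) blast
  have J_bound: "(\<integral>\<^sup>+\<omega>. ennreal ((J k \<omega>)\<^sup>2) \<partial>M) \<le> ennreal (3 * \<epsilon> powr (2 * H))" for k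
  proof (rule nn_integral_square_limit_le[OF _ lim_S])
    show "\<forall>\<^sub>F m in sequentially. (\<integral>\<^sup>+\<omega>. ennreal ((S (- real (Suc k)) m \<omega>)\<^sup>2) \<partial>M) \<le> ennreal (3 * \<epsilon> powr (2 * H))"
      using eventually_gt_at_top[of 0]
    proof eventually_elim
      case (elim m)
      then show ?case unfolding S_def
        by (intro kernel_average_second_moment[OF eps mono_grid grid_last]) auto
    qed
  qed measurable
  show ?thesis
    by (rule nn_integral_square_limit_le[OF _ lim_J]) (simp_all add: J_bound)
qed

text \<open>
  \<open>D t\<close> is the sum of the damped initial value and a limit of averages of increments over \<open>[0, t]\<close>.
  Each has second moment at most \<open>3 * \<epsilon> powr (2 * H)\<close>, and \<open>(x + y)\<^sup>2 \<le> 2 * x\<^sup>2 + 2 * y\<^sup>2\<close> makes this \<open>12\<close>.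
\<close>
lemma D_second_moment:
  assumes "0 \<le> t"
  shows "integrable M (\<lambda>\<omega>. (D t \<omega>)\<^sup>2)" "integral\<^sup>L M (\<lambda>\<omega>. (D t \<omega>)\<^sup>2) \<le> 12 * \<epsilon> powr (2 * H)"
proof -
  note [measurable] = D_measurable[OF assms] D_measurable[OF order_refl]
  define G where "G \<omega> = D t \<omega> - exp (- t / \<epsilon>) * D 0 \<omega>" for \<omega>
  have [measurable]: "G \<in> borel_measurable M" unfolding G_def by measurable
  have G: "(\<integral>\<^sup>+\<omega>. ennreal ((G \<omega>)\<^sup>2) \<partial>M) \<le> ennreal (3 * \<epsilon> powr (2 * H))"
  proof (rule nn_integral_square_limit_le)
    show "AE \<omega> in M. (\<lambda>m. \<Sum>i\<le>m. kernel_weight \<epsilon> t (grid 0 t m) i * (B t \<omega> - B (grid 0 t m i) \<omega>)) \<longlonglongrightarrow> G \<omega>"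
      using AE_D_facts
    proof eventually_elim
      case (elim \<omega>)
      then show ?case
        unfolding G_def
        by (intro linear_ode_limit[where D = "\<lambda>t. D t \<omega>" and B = "\<lambda>t. B t \<omega>", OF eps assms]) blast+
    qed
    show "\<forall>\<^sub>F m in sequentially. (\<integral>\<^sup>+\<omega>. ennreal ((\<Sum>i\<le>m. kernel_weight \<epsilon> t (grid 0 t m) i * (B t \<omega> - B (grid 0 t m i) \<omega>))\<^sup>2) \<partial>M)
        \<le> ennreal (3 * \<epsilon> powr (2 * H))"
      using eventually_gt_at_top[of 0]
    proof eventually_elim
      case (elim m)
      then show ?case
        by (intro kernel_average_second_moment[OF eps mono_grid[OF assms] grid_last])
    qed
  qed measurable
  have le: "(D t \<omega>)\<^sup>2 \<le> 2 * (D 0 \<omega>)\<^sup>2 + 2 * (G \<omega>)\<^sup>2" for \<omega>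
  proof -
    define x where "x = exp (- t / \<epsilon>) * D 0 \<omega>"
    have "exp (- t / \<epsilon>) \<le> 1" using assms eps by simp
    then have "\<bar>x\<bar> \<le> \<bar>D 0 \<omega>\<bar>" by (simp add: x_def abs_mult mult_left_le_one_le)
    then have "x\<^sup>2 \<le> (D 0 \<omega>)\<^sup>2" by (simp add: abs_le_square_iff)
    moreover have "(D t \<omega>)\<^sup>2 = (x + G \<omega>)\<^sup>2" by (simp add: G_def x_def)
    moreover have "(x + G \<omega>)\<^sup>2 \<le> 2 * x\<^sup>2 + 2 * (G \<omega>)\<^sup>2"
      using zero_le_power2[of "x - G \<omega>"] by (simp add: power2_eq_square algebra_simps)
    ultimately show ?thesis by simp
  qed
  have "(\<integral>\<^sup>+\<omega>. ennreal ((D t \<omega>)\<^sup>2) \<partial>M) \<le> (\<integral>\<^sup>+\<omega>. 2 * ennreal ((D 0 \<omega>)\<^sup>2) + 2 * ennreal ((G \<omega>)\<^sup>2) \<partial>M)"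
  proof (rule nn_integral_mono)
    fix \<omega>
    show "ennreal ((D t \<omega>)\<^sup>2) \<le> 2 * ennreal ((D 0 \<omega>)\<^sup>2) + 2 * ennreal ((G \<omega>)\<^sup>2)"
      using ennreal_leI[OF le[of \<omega>]] by (simp add: ennreal_mult ennreal_plus)
  qed
  also have "\<dots> = 2 * (\<integral>\<^sup>+\<omega>. ennreal ((D 0 \<omega>)\<^sup>2) \<partial>M) + 2 * (\<integral>\<^sup>+\<omega>. ennreal ((G \<omega>)\<^sup>2) \<partial>M)"
    by (simp add: nn_integral_add nn_integral_cmult)
  also have "\<dots> \<le> 2 * ennreal (3 * \<epsilon> powr (2 * H)) + 2 * ennreal (3 * \<epsilon> powr (2 * H))"
    by (intro add_mono mult_left_mono nn_integral_D_0 G) auto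
  also have "\<dots> = ennreal (12 * \<epsilon> powr (2 * H))"
    by (simp add: ennreal_mult flip: mult.assoc distrib_right)
  finally have bound: "(\<integral>\<^sup>+\<omega>. ennreal ((D t \<omega>)\<^sup>2) \<partial>M) \<le> ennreal (12 * \<epsilon> powr (2 * H))" .
  show int: "integrable M (\<lambda>\<omega>. (D t \<omega>)\<^sup>2)"
  proof (rule integrableI_nonneg)
    show "(\<integral>\<^sup>+\<omega>. ennreal ((D t \<omega>)\<^sup>2) \<partial>M) < \<infinity>"
      using bound by (rule le_less_trans) simp
  qed simp_all
  show "integral\<^sup>L M (\<lambda>\<omega>. (D t \<omega>)\<^sup>2) \<le> 12 * \<epsilon> powr (2 * H)"
    using bound by (subst (asm) nn_integral_eq_integral[OF int]) (auto simp: ennreal_le_iff)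
qed

end

end

section \<open>Convergence in probability\<close>

lemma (in prob_space) measure_exceed_le:
  fixes Z :: "'a \<Rightarrow> real"
  assumes "integrable M (\<lambda>\<omega>. \<bar>Z \<omega> - c\<bar> ^ k)" "0 < \<eta>" and [measurable]: "Z \<in> borel_measurable M"
  shows "measure M {\<omega> \<in> space M. \<bar>Z \<omega> - c\<bar> > \<eta>} \<le> integral\<^sup>L M (\<lambda>\<omega>. \<bar>Z \<omega> - c\<bar> ^ k) / \<eta> ^ k"
proof -
  have "measure M {\<omega> \<in> space M. \<bar>Z \<omega> - c\<bar> > \<eta>} \<le> measure M {\<omega> \<in> space M. \<bar>Z \<omega> - c\<bar> ^ k \<ge> \<eta> ^ k}"
    using assms(2) by (intro finite_measure_mono) (auto intro!: power_mono)
  also have "\<dots> \<le> integral\<^sup>L M (\<lambda>\<omega>. \<bar>Z \<omega> - c\<bar> ^ k) / \<eta> ^ k"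
    using assms by (intro integral_Markov_inequality_measure[where A = "space M"]) auto
  finally show ?thesis .
qed

lemma tendsto_in_prob_if_moment_tendsto_0:
  assumes "prob_space M"
    and "\<forall>\<^sub>F i in F. Z i \<in> borel_measurable M \<and> integrable M (\<lambda>\<omega>. \<bar>Z i \<omega> - c\<bar> ^ k)
      \<and> integral\<^sup>L M (\<lambda>\<omega>. \<bar>Z i \<omega> - c\<bar> ^ k) \<le> b i"
    and "(b \<longlongrightarrow> 0) F"
  shows "tendsto_in_prob M Z c F"
  unfolding tendsto_in_prob_def
proof (intro conjI allI impI)
  interpret prob_space M by fact
  show "\<forall>\<^sub>F i in F. Z i \<in> borel_measurable M"
    using assms(2) by eventually_elim auto
  fix \<eta> :: real assume "0 < \<eta>"
  show "((\<lambda>i. measure M {\<omega> \<in> space M. \<bar>Z i \<omega> - c\<bar> > \<eta>}) \<longlongrightarrow> 0) F"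
  proof (rule tendsto_sandwich[where f = "\<lambda>_. 0"])
    show "((\<lambda>i. b i / \<eta> ^ k) \<longlongrightarrow> 0) F"
      using assms(3) \<open>0 < \<eta>\<close> by (intro tendsto_divide_zero)
    show "\<forall>\<^sub>F i in F. measure M {\<omega> \<in> space M. \<bar>Z i \<omega> - c\<bar> > \<eta>} \<le> b i / \<eta> ^ k"
      using assms(2)
    proof eventually_elim
      case (elim i)
      then have "measure M {\<omega> \<in> space M. \<bar>Z i \<omega> - c\<bar> > \<eta>} \<le> integral\<^sup>L M (\<lambda>\<omega>. \<bar>Z i \<omega> - c\<bar> ^ k) / \<eta> ^ k"
        using \<open>0 < \<eta>\<close> by (intro measure_exceed_le) auto
      also have "\<dots> \<le> b i / \<eta> ^ k"
        using elim \<open>0 < \<eta>\<close> by (intro divide_right_mono) auto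
      finally show ?case .
    qed
  qed auto
qed

text \<open>
  One form of the continuous mapping theorem that serves two purposes: transporting convergence
  through a function continuous at the limit point only, and comparing a variable with two convergent
  ones.
\<close>
lemma tendsto_in_prob_by_continuous_bound:
  fixes g :: "real \<times> real \<Rightarrow> real"
  assumes "prob_space M"
    and U: "tendsto_in_prob M U a F" and W: "tendsto_in_prob M W b F"
    and Z: "\<forall>\<^sub>F i in F. Z i \<in> borel_measurable M"
    and g: "isCont g (a, b)" "g (a, b) = 0"
    and bound: "\<forall>\<^sub>F i in F. AE \<omega> in M. \<bar>Z i \<omega> - c\<bar> \<le> g (U i \<omega>, W i \<omega>)"
  shows "tendsto_in_prob M Z c F"
  unfolding tendsto_in_prob_def
proof (intro conjI allI impI Z)
  interpret prob_space M by fact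
  fix \<eta> :: real assume "0 < \<eta>"
  then obtain d where "0 < d" and d: "\<And>z. dist z (a, b) < d \<Longrightarrow> g z < \<eta>"
    using g unfolding continuous_at_eps_delta dist_real_def by (metis abs_ge_self diff_0_right le_less_trans)
  define P where "P i = {\<omega> \<in> space M. \<bar>U i \<omega> - a\<bar> > d / 3}" for i
  define Q where "Q i = {\<omega> \<in> space M. \<bar>W i \<omega> - b\<bar> > d / 3}" for i
  show "((\<lambda>i. measure M {\<omega> \<in> space M. \<bar>Z i \<omega> - c\<bar> > \<eta>}) \<longlongrightarrow> 0) F"
  proof (rule tendsto_sandwich[where f = "\<lambda>_. 0"])
    have "((\<lambda>i. measure M (P i)) \<longlongrightarrow> 0) F" "((\<lambda>i. measure M (Q i)) \<longlongrightarrow> 0) F"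
      using U W divide_pos_pos[OF \<open>0 < d\<close> zero_less_numeral] unfolding tendsto_in_prob_def P_def Q_def by blast+
    then show "((\<lambda>i. measure M (P i) + measure M (Q i)) \<longlongrightarrow> 0) F"
      using tendsto_add[of "\<lambda>i. measure M (P i)" 0 F "\<lambda>i. measure M (Q i)" 0] by simp
    have "\<forall>\<^sub>F i in F. U i \<in> borel_measurable M" "\<forall>\<^sub>F i in F. W i \<in> borel_measurable M"
      using U W by (simp_all add: tendsto_in_prob_def)
    then show "\<forall>\<^sub>F i in F. measure M {\<omega> \<in> space M. \<bar>Z i \<omega> - c\<bar> > \<eta>} \<le> measure M (P i) + measure M (Q i)"
      using Z bound
    proof eventually_elim
      case (elim i)
      note [measurable] = elim(1-3)
      have [measurable]: "P i \<in> sets M" "Q i \<in> sets M" unfolding P_def Q_def by measurable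
      have "measure M {\<omega> \<in> space M. \<bar>Z i \<omega> - c\<bar> > \<eta>} \<le> measure M (P i \<union> Q i)"
      proof (rule finite_measure_mono_AE)
        show "AE \<omega> in M. \<omega> \<in> {\<omega> \<in> space M. \<bar>Z i \<omega> - c\<bar> > \<eta>} \<longrightarrow> \<omega> \<in> P i \<union> Q i"
          using elim(4)
        proof eventually_elim
          case (elim \<omega>)
          show ?case
          proof (intro impI, rule ccontr)
            assume A: "\<omega> \<in> {\<omega> \<in> space M. \<bar>Z i \<omega> - c\<bar> > \<eta>}" "\<omega> \<notin> P i \<union> Q i"
            then have "\<bar>U i \<omega> - a\<bar> \<le> d / 3" "\<bar>W i \<omega> - b\<bar> \<le> d / 3"
              by (auto simp: P_def Q_def)
            moreover have "dist (U i \<omega>, W i \<omega>) (a, b) \<le> \<bar>U i \<omega> - a\<bar> + \<bar>W i \<omega> - b\<bar>"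
              using sqrt_sum_squares_le_sum_abs[of "U i \<omega> - a" "W i \<omega> - b"]
              by (simp add: dist_prod_def dist_real_def)
            ultimately have "dist (U i \<omega>, W i \<omega>) (a, b) < d" using \<open>0 < d\<close> by linarith
            then have "g (U i \<omega>, W i \<omega>) < \<eta>" by (rule d)
            with elim A show False by auto
          qed
        qed
      qed simp
      also have "\<dots> \<le> measure M (P i) + measure M (Q i)"
        by (rule measure_Un_le) simp_all
      finally show ?case .
    qed
  qed auto
qed

section \<open>Scaled quadratic variations of second order\<close>

definition scaled_variation :: "real \<Rightarrow> nat \<Rightarrow> real \<Rightarrow> (real \<Rightarrow> real) \<Rightarrow> real" where
  "scaled_variation p n d x = (\<Sum>k=2..n. (second_diff x d k)\<^sup>2) / (real n * d powr p)"

lemma scaled_variation_nonneg: "0 \<le> scaled_variation p n d x"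
  by (simp add: scaled_variation_def sum_nonneg)

text \<open>
  The square root of the scaled variation is a multiple of the Euclidean norm of the vector of second
  differences, so it satisfies the triangle inequality; factoring the difference of squares gives
  the bound.
\<close>
lemma scaled_variation_diff:
  "\<bar>scaled_variation p n d (\<lambda>t. x t - y t) - c\<bar>
     \<le> \<bar>scaled_variation p n d x - c\<bar>
       + sqrt (scaled_variation p n d y) * (2 * sqrt (scaled_variation p n d x) + sqrt (scaled_variation p n d y))"
proof -
  let ?D = "\<lambda>x. L2_set (second_diff x d) {2..n}"
  define s where "s = sqrt (real n * d powr p)"
  have "0 \<le> s" by (simp add: s_def)
  have sqrt_eq: "sqrt (scaled_variation p n d z) = ?D z / s" for z
    by (simp add: scaled_variation_def L2_set_def real_sqrt_divide s_def)
  define a b r where "a = ?D x / s" and "b = ?D y / s" and "r = ?D (\<lambda>t. x t - y t) / s"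
  have diff: "second_diff (\<lambda>t. x t - y t) d k = second_diff x d k + - second_diff y d k" for k
    by (simp add: second_diff_def)
  have neg: "L2_set (\<lambda>k. - second_diff y d k) {2..n} = ?D y"
    by (simp add: L2_set_def)
  have "?D (\<lambda>t. x t - y t) \<le> ?D x + ?D y"
    unfolding diff[abs_def] neg[symmetric] by (rule L2_set_triangle_ineq)
  moreover have "?D x \<le> ?D (\<lambda>t. x t - y t) + ?D y"
  proof -
    have "?D x = L2_set (\<lambda>k. second_diff (\<lambda>t. x t - y t) d k + second_diff y d k) {2..n}"
      by (simp add: diff)
    also have "\<dots> \<le> ?D (\<lambda>t. x t - y t) + ?D y"
      by (rule L2_set_triangle_ineq)
    finally show ?thesis .
  qed
  ultimately have "r \<le> a + b" "a \<le> r + b"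
    using \<open>0 \<le> s\<close> unfolding a_def b_def r_def by (simp_all add: divide_right_mono flip: add_divide_distrib)
  moreover have "0 \<le> a" "0 \<le> b" "0 \<le> r"
    using \<open>0 \<le> s\<close> by (simp_all add: a_def b_def r_def L2_set_nonneg)
  ultimately have "\<bar>r - a\<bar> * (r + a) \<le> b * (2 * a + b)"
    by (intro mult_mono) auto
  moreover have "\<bar>r\<^sup>2 - a\<^sup>2\<bar> = \<bar>r - a\<bar> * (r + a)"
    using \<open>0 \<le> a\<close> \<open>0 \<le> r\<close> by (simp add: power2_eq_square square_diff_square_factored abs_mult)
  moreover have "scaled_variation p n d z = (?D z / s)\<^sup>2" for z
    using sqrt_eq[of z] scaled_variation_nonneg[of p n d z] by (metis real_sqrt_pow2)
  ultimately show ?thesis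
    unfolding sqrt_eq by (simp add: a_def b_def r_def)
qed

context fBm
begin

text \<open>
  There are \<open>n - 1\<close> summands but the normalization is by \<open>n\<close>; this bias of \<open>\<kappa> / n\<close> accounts for the last
  term.
\<close>
lemma scaled_variation_B_L2:
  assumes "0 < d" "0 < n"
  defines "v \<equiv> \<lambda>\<omega>. scaled_variation (2 * H) n d (\<lambda>t. B t \<omega>)" and "\<kappa> \<equiv> 4 - 2 powr (2 * H)"
  shows "v \<in> borel_measurable M" "integrable M (\<lambda>\<omega>. (v \<omega> - \<kappa>)\<^sup>2)"
    "integral\<^sup>L M (\<lambda>\<omega>. (v \<omega> - \<kappa>)\<^sup>2)
       \<le> 8 * ((\<Sum>m<n. (second_diff_cov (2 * H) (real m))\<^sup>2) / real n) + 2 * \<kappa>\<^sup>2 / (real n)\<^sup>2"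
proof -
  define U where "U k \<omega> = second_diff (\<lambda>t. B t \<omega>) d k" for k \<omega>
  define q where "q = d powr (2 * H)"
  define R where "R = (\<Sum>m<n. (second_diff_cov (2 * H) (real m))\<^sup>2)"
  have "0 < q" using assms(1) by (simp add: q_def)
  have cov: "integral\<^sup>L M (\<lambda>\<omega>. U j \<omega> * U k \<omega>) = q * second_diff_cov (2 * H) (real j - real k)" for j k
    unfolding U_def q_def by (rule second_diff_covariance[OF assms(1)])
  have var: "integral\<^sup>L M (\<lambda>\<omega>. (U k \<omega>)\<^sup>2) = q * \<kappa>" for k
    using cov[of k k] by (simp add: power2_eq_square second_diff_cov_0 \<kappa>_def)
  have U_span: "U k \<in> B_span" for k
    unfolding U_def by (rule second_diff_in_span)
  have meas [measurable]: "U k \<in> borel_measurable M" for k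
    using gaussian_span[OF U_span] by (simp add: gaussian_rv_def)
  define S where "S \<omega> = (\<Sum>k=2..n. (U k \<omega>)\<^sup>2 - q * \<kappa>)" for \<omega>
  have v_eq: "v \<omega> = (\<Sum>k=2..n. (U k \<omega>)\<^sup>2) / (real n * q)" for \<omega>
    by (simp add: v_def scaled_variation_def U_def q_def)
  show [measurable]: "v \<in> borel_measurable M"
    unfolding v_eq[abs_def] by measurable
  have S_int: "integrable M (\<lambda>\<omega>. (S \<omega>)\<^sup>2)"
    and S_var: "integral\<^sup>L M (\<lambda>\<omega>. (S \<omega>)\<^sup>2) = 2 * (\<Sum>j=2..n. \<Sum>k=2..n. (q * second_diff_cov (2 * H) (real j - real k))\<^sup>2)"
    using variance_sum_squares[OF prob_space_axioms gaussian_space_span, of "{2..n}" U] U_span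
    by (simp_all add: S_def var cov)
  have "(\<Sum>j=2..n. \<Sum>k=2..n. (q * second_diff_cov (2 * H) (real j - real k))\<^sup>2)
      = q\<^sup>2 * (\<Sum>j=2..n. \<Sum>k=2..n. (second_diff_cov (2 * H) (real j - real k))\<^sup>2)"
    by (simp add: power_mult_distrib sum_distrib_left)
  also have "\<dots> \<le> q\<^sup>2 * (2 * real n * R)"
    unfolding R_def by (intro mult_left_mono sum_double_even_le) (auto simp: second_diff_cov_minus)
  finally have S_bound: "integral\<^sup>L M (\<lambda>\<omega>. (S \<omega>)\<^sup>2) \<le> 2 * (q\<^sup>2 * (2 * real n * R))"
    unfolding S_var by (rule mult_left_mono) simp
  have "real (card {2..n}) = real n - 1" using assms(2) by simp
  then have "S \<omega> = real n * q * v \<omega> - (real n - 1) * (q * \<kappa>)" for \<omega>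
    using \<open>0 < q\<close> assms(2) by (simp add: S_def v_eq sum_subtractf)
  then have dev: "v \<omega> - \<kappa> = S \<omega> / (real n * q) - \<kappa> / real n" for \<omega>
    using \<open>0 < q\<close> assms(2) by (simp add: field_simps)
  have le: "(v \<omega> - \<kappa>)\<^sup>2 \<le> 2 / (real n * q)\<^sup>2 * (S \<omega>)\<^sup>2 + 2 * \<kappa>\<^sup>2 / (real n)\<^sup>2" for \<omega>
  proof -
    have "(x - y)\<^sup>2 \<le> 2 * x\<^sup>2 + 2 * y\<^sup>2" for x y :: real
      using zero_le_power2[of "x + y"] by (simp add: power2_eq_square algebra_simps)
    from this[of "S \<omega> / (real n * q)" "\<kappa> / real n"] show ?thesis
      by (simp add: dev power_divide)
  qed
  have int: "integrable M (\<lambda>\<omega>. 2 / (real n * q)\<^sup>2 * (S \<omega>)\<^sup>2 + 2 * \<kappa>\<^sup>2 / (real n)\<^sup>2)"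
    using S_int by simp
  show int': "integrable M (\<lambda>\<omega>. (v \<omega> - \<kappa>)\<^sup>2)"
    by (rule Bochner_Integration.integrable_bound[OF int]) (use le in \<open>auto intro: order_trans[OF _ abs_ge_self]\<close>)
  have "integral\<^sup>L M (\<lambda>\<omega>. (v \<omega> - \<kappa>)\<^sup>2) \<le> integral\<^sup>L M (\<lambda>\<omega>. 2 / (real n * q)\<^sup>2 * (S \<omega>)\<^sup>2 + 2 * \<kappa>\<^sup>2 / (real n)\<^sup>2)"
    by (rule integral_mono[OF int' int le])
  also have "\<dots> = 2 / (real n * q)\<^sup>2 * integral\<^sup>L M (\<lambda>\<omega>. (S \<omega>)\<^sup>2) + 2 * \<kappa>\<^sup>2 / (real n)\<^sup>2"
    using S_int by (simp add: prob_space)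
  also have "\<dots> \<le> 2 / (real n * q)\<^sup>2 * (2 * (q\<^sup>2 * (2 * real n * R))) + 2 * \<kappa>\<^sup>2 / (real n)\<^sup>2"
    by (intro add_right_mono mult_left_mono S_bound) auto
  also have "2 / (real n * q)\<^sup>2 * (2 * (q\<^sup>2 * (2 * real n * R))) = 8 * (R / real n)"
    using \<open>0 < q\<close> assms(2) by (simp add: field_simps power2_eq_square)
  finally show "integral\<^sup>L M (\<lambda>\<omega>. (v \<omega> - \<kappa>)\<^sup>2)
       \<le> 8 * ((\<Sum>m<n. (second_diff_cov (2 * H) (real m))\<^sup>2) / real n) + 2 * \<kappa>\<^sup>2 / (real n)\<^sup>2"
    by (simp add: R_def)
qed

lemma scaled_variation_B_tendsto:
  assumes "filterlim n sequentially F" "\<forall>\<^sub>F i in F. 0 < d i"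
  shows "tendsto_in_prob M (\<lambda>i \<omega>. scaled_variation (2 * H) (n i) (d i) (\<lambda>t. B t \<omega>)) (4 - 2 powr (2 * H)) F"
proof (rule tendsto_in_prob_if_moment_tendsto_0[where k = 2, OF prob_space_axioms])
  define b where "b n = 8 * ((\<Sum>m<n. (second_diff_cov (2 * H) (real m))\<^sup>2) / real n)
      + 2 * (4 - 2 powr (2 * H))\<^sup>2 / (real n)\<^sup>2" for n :: nat
  have "(\<lambda>m. second_diff_cov (2 * H) (real m)) \<longlonglongrightarrow> 0"
    using H_less_1 by (intro second_diff_cov_tendsto_0) simp
  from tendsto_power[OF this, of 2] have "(\<lambda>m. (second_diff_cov (2 * H) (real m))\<^sup>2) \<longlonglongrightarrow> 0" by simp
  from cesaro_tendsto_0[OF this]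
  have "(\<lambda>n. 8 * ((\<Sum>m<n. (second_diff_cov (2 * H) (real m))\<^sup>2) / real n)) \<longlonglongrightarrow> 0"
    by (rule tendsto_mult_right_zero)
  moreover have "(\<lambda>n. 2 * (4 - 2 powr (2 * H))\<^sup>2 / (real n)\<^sup>2) \<longlonglongrightarrow> 0"
    by real_asymp
  ultimately have "b \<longlonglongrightarrow> 0"
    unfolding b_def using tendsto_add by fastforce
  then show "((\<lambda>i. b (n i)) \<longlongrightarrow> 0) F"
    by (rule filterlim_compose[OF _ assms(1)])
  have "\<forall>\<^sub>F i in F. 0 < n i"
    using assms(1) eventually_gt_at_top[of 0] by (simp add: filterlim_iff)
  with assms(2) show "\<forall>\<^sub>F i in F. (\<lambda>\<omega>. scaled_variation (2 * H) (n i) (d i) (\<lambda>t. B t \<omega>)) \<in> borel_measurable M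
      \<and> integrable M (\<lambda>\<omega>. \<bar>scaled_variation (2 * H) (n i) (d i) (\<lambda>t. B t \<omega>) - (4 - 2 powr (2 * H))\<bar>\<^sup>2)
      \<and> integral\<^sup>L M (\<lambda>\<omega>. \<bar>scaled_variation (2 * H) (n i) (d i) (\<lambda>t. B t \<omega>) - (4 - 2 powr (2 * H))\<bar>\<^sup>2) \<le> b (n i)"
  proof eventually_elim
    case (elim i)
    from scaled_variation_B_L2[OF elim] show ?case unfolding power2_abs b_def by blast
  qed
qed

end

text \<open>
  By the Cauchy--Schwarz inequality, \<open>(x - 2 * y + z)\<^sup>2 \<le> 3 * (x\<^sup>2 + 4 * y\<^sup>2 + z\<^sup>2)\<close>, which costs
  the factor \<open>18\<close>.
\<close>
lemma scaled_variation_second_moment: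
  fixes D :: "real \<Rightarrow> 'a \<Rightarrow> real"
  assumes "prob_space M" "0 < d" "0 < n" "0 \<le> K"
    and meas: "\<And>t. 0 \<le> t \<Longrightarrow> D t \<in> borel_measurable M"
    and int: "\<And>t. 0 \<le> t \<Longrightarrow> integrable M (\<lambda>\<omega>. (D t \<omega>)\<^sup>2)"
    and le: "\<And>t. 0 \<le> t \<Longrightarrow> integral\<^sup>L M (\<lambda>\<omega>. (D t \<omega>)\<^sup>2) \<le> K"
  shows "(\<lambda>\<omega>. scaled_variation p n d (\<lambda>t. D t \<omega>)) \<in> borel_measurable M"
    "integrable M (\<lambda>\<omega>. scaled_variation p n d (\<lambda>t. D t \<omega>))"
    "integral\<^sup>L M (\<lambda>\<omega>. scaled_variation p n d (\<lambda>t. D t \<omega>)) \<le> 18 * K / d powr p"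
proof -
  have times: "0 \<le> real k * d" "0 \<le> (real k - 1) * d" "0 \<le> (real k - 2) * d" if "k \<in> {2..n}" for k
    using that assms(2) by (auto intro!: mult_nonneg_nonneg)
  have sq_meas: "(\<lambda>\<omega>. (second_diff (\<lambda>t. D t \<omega>) d k)\<^sup>2) \<in> borel_measurable M" if "k \<in> {2..n}" for k
    unfolding second_diff_def
    by (intro borel_measurable_power borel_measurable_add borel_measurable_diff borel_measurable_times
        borel_measurable_const meas times[OF that])
  show "(\<lambda>\<omega>. scaled_variation p n d (\<lambda>t. D t \<omega>)) \<in> borel_measurable M"
    unfolding scaled_variation_def by (intro borel_measurable_divide borel_measurable_sum sq_meas) auto
  define E where "E k \<omega> = 3 * ((D (real k * d) \<omega>)\<^sup>2 + 4 * (D ((real k - 1) * d) \<omega>)\<^sup>2 + (D ((real k - 2) * d) \<omega>)\<^sup>2)"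
    for k \<omega>
  have sq_le: "(second_diff (\<lambda>t. D t \<omega>) d k)\<^sup>2 \<le> E k \<omega>" for k \<omega>
  proof -
    have "(x - 2 * y + z)\<^sup>2 \<le> 3 * (x\<^sup>2 + 4 * y\<^sup>2 + z\<^sup>2)" for x y z :: real
      using zero_le_power2[of "x + 2 * y"] zero_le_power2[of "z + 2 * y"] zero_le_power2[of "x - z"]
      by (simp add: power2_eq_square algebra_simps)
    then show ?thesis by (simp add: second_diff_def E_def)
  qed
  have E_int: "integrable M (E k)" if "k \<in> {2..n}" for k
    unfolding E_def using int times[OF that] by simp
  have E_le: "integral\<^sup>L M (E k) \<le> 18 * K" if "k \<in> {2..n}" for k
  proof -
    have "integral\<^sup>L M (E k) = 3 * (integral\<^sup>L M (\<lambda>\<omega>. (D (real k * d) \<omega>)\<^sup>2)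
        + 4 * integral\<^sup>L M (\<lambda>\<omega>. (D ((real k - 1) * d) \<omega>)\<^sup>2) + integral\<^sup>L M (\<lambda>\<omega>. (D ((real k - 2) * d) \<omega>)\<^sup>2))"
      unfolding E_def using int times[OF that] by simp
    also have "\<dots> \<le> 3 * (K + 4 * K + K)"
      by (intro mult_left_mono add_mono le times[OF that]) auto
    finally show ?thesis by simp
  qed
  have sq_int: "integrable M (\<lambda>\<omega>. (second_diff (\<lambda>t. D t \<omega>) d k)\<^sup>2)" if "k \<in> {2..n}" for k
    by (rule Bochner_Integration.integrable_bound[OF E_int[OF that] sq_meas[OF that]])
       (use sq_le in \<open>auto intro: order_trans[OF _ abs_ge_self]\<close>)
  show "integrable M (\<lambda>\<omega>. scaled_variation p n d (\<lambda>t. D t \<omega>))"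
    unfolding scaled_variation_def by (intro integrable_divide Bochner_Integration.integrable_sum sq_int)
  have "integral\<^sup>L M (\<lambda>\<omega>. scaled_variation p n d (\<lambda>t. D t \<omega>))
      = (\<Sum>k=2..n. integral\<^sup>L M (\<lambda>\<omega>. (second_diff (\<lambda>t. D t \<omega>) d k)\<^sup>2)) / (real n * d powr p)"
    unfolding scaled_variation_def using sq_int by simp
  also have "\<dots> \<le> (\<Sum>k=2..n. 18 * K) / (real n * d powr p)"
  proof (intro divide_right_mono sum_mono)
    fix k assume k: "k \<in> {2..n}"
    have "integral\<^sup>L M (\<lambda>\<omega>. (second_diff (\<lambda>t. D t \<omega>) d k)\<^sup>2) \<le> integral\<^sup>L M (E k)"
      by (rule integral_mono[OF sq_int[OF k] E_int[OF k] sq_le])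
    with E_le[OF k] show "integral\<^sup>L M (\<lambda>\<omega>. (second_diff (\<lambda>t. D t \<omega>) d k)\<^sup>2) \<le> 18 * K" by simp
  qed simp
  also have "\<dots> \<le> (real n * (18 * K)) / (real n * d powr p)"
    using assms(4) by (intro divide_right_mono) (auto intro!: mult_right_mono)
  also have "\<dots> = 18 * K / d powr p" using assms(3) by simp
  finally show "integral\<^sup>L M (\<lambda>\<omega>. scaled_variation p n d (\<lambda>t. D t \<omega>)) \<le> 18 * K / d powr p" .
qed

section \<open>Consistency of the estimator\<close>

text \<open>
  The step is kept independent of the horizon, so that the statement applies to the grids of step
  \<open>\<delta>\<close> and \<open>\<delta> / 2\<close> alike.  The constant \<open>216\<close> in the proof is \<open>18 * 12\<close>.
\<close>
lemma scaled_variation_X_tendsto: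
  fixes X Y :: "real \<Rightarrow> real \<Rightarrow> 'a \<Rightarrow> real" and n :: "real \<Rightarrow> nat" and d :: "real \<Rightarrow> real"
  assumes "fBm M H B" "\<sigma>1 \<noteq> 0" "\<sigma>2 \<noteq> 0"
    and kin: "\<And>\<epsilon>. \<epsilon> > 0 \<Longrightarrow> kinetic_fBm M B H \<sigma>1 \<sigma>2 x0 \<epsilon> (X \<epsilon>) (Y \<epsilon>)"
    and n: "filterlim n sequentially (at_right 0)"
    and d: "\<And>\<epsilon>. 0 < \<epsilon> \<Longrightarrow> 0 < d \<epsilon>"
    and ratio: "((\<lambda>\<epsilon>. \<epsilon> / d \<epsilon>) \<longlongrightarrow> 0) (at_right 0)"
  shows "tendsto_in_prob M (\<lambda>\<epsilon> \<omega>. scaled_variation (2 * H) (n \<epsilon>) (d \<epsilon>) (\<lambda>t. X \<epsilon> t \<omega>) / (\<sigma>1 * \<sigma>2)\<^sup>2)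
           (4 - 2 powr (2 * H)) (at_right 0)"
proof -
  interpret fBm M H B by fact
  define \<kappa> where "\<kappa> = 4 - 2 powr (2 * H)"
  define OU where "OU \<epsilon> = kernel_integral H \<epsilon> \<sigma>2 (Y \<epsilon>)" for \<epsilon>
  have pos: "\<forall>\<^sub>F \<epsilon> in at_right 0. (0 :: real) < \<epsilon>"
    by (rule eventually_at_right_less)
  have n_pos: "\<forall>\<^sub>F \<epsilon> in at_right 0. 0 < n \<epsilon>"
    using n eventually_gt_at_top[of 0] by (simp add: filterlim_iff)
  have OU_meas: "OU \<epsilon> t \<in> borel_measurable M" if "0 < \<epsilon>" "0 \<le> t" for \<epsilon> t
    unfolding OU_def by (rule D_measurable[OF kin[OF that(1)] that(1) assms(3) that(2)])
  have OU_int: "integrable M (\<lambda>\<omega>. (OU \<epsilon> t \<omega>)\<^sup>2)"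
    and OU_le: "integral\<^sup>L M (\<lambda>\<omega>. (OU \<epsilon> t \<omega>)\<^sup>2) \<le> 12 * \<epsilon> powr (2 * H)" if "0 < \<epsilon>" "0 \<le> t" for \<epsilon> t
    unfolding OU_def by (rule D_second_moment[OF kin[OF that(1)] that(1) assms(3) that(2)])+
  have v: "tendsto_in_prob M (\<lambda>\<epsilon> \<omega>. scaled_variation (2 * H) (n \<epsilon>) (d \<epsilon>) (\<lambda>t. B t \<omega>)) \<kappa> (at_right 0)"
    unfolding \<kappa>_def by (rule scaled_variation_B_tendsto[OF n eventually_mono[OF pos]]) (rule d)
  have w: "tendsto_in_prob M (\<lambda>\<epsilon> \<omega>. scaled_variation (2 * H) (n \<epsilon>) (d \<epsilon>) (\<lambda>t. OU \<epsilon> t \<omega>)) 0 (at_right 0)"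
  proof (rule tendsto_in_prob_if_moment_tendsto_0[where k = 1, OF prob_space_axioms])
    have "((\<lambda>\<epsilon>. (\<epsilon> / d \<epsilon>) powr (2 * H)) \<longlongrightarrow> 0 powr (2 * H)) (at_right 0)"
    proof (intro tendsto_powr' ratio tendsto_const disjI2 conjI)
      show "0 < 2 * H" using H_pos by simp
      show "\<forall>\<^sub>F \<epsilon> in at_right 0. 0 \<le> \<epsilon> / d \<epsilon>"
        by (rule eventually_mono[OF pos]) (simp add: d less_imp_le)
    qed
    then show "((\<lambda>\<epsilon>. 216 * (\<epsilon> / d \<epsilon>) powr (2 * H)) \<longlongrightarrow> 0) (at_right 0)"
      by (intro tendsto_mult_right_zero) simp
    show "\<forall>\<^sub>F \<epsilon> in at_right 0. (\<lambda>\<omega>. scaled_variation (2 * H) (n \<epsilon>) (d \<epsilon>) (\<lambda>t. OU \<epsilon> t \<omega>)) \<in> borel_measurable M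
      \<and> integrable M (\<lambda>\<omega>. \<bar>scaled_variation (2 * H) (n \<epsilon>) (d \<epsilon>) (\<lambda>t. OU \<epsilon> t \<omega>) - 0\<bar> ^ 1)
      \<and> integral\<^sup>L M (\<lambda>\<omega>. \<bar>scaled_variation (2 * H) (n \<epsilon>) (d \<epsilon>) (\<lambda>t. OU \<epsilon> t \<omega>) - 0\<bar> ^ 1)
          \<le> 216 * (\<epsilon> / d \<epsilon>) powr (2 * H)"
      using pos n_pos
    proof eventually_elim
      case (elim \<epsilon>)
      have "0 \<le> 12 * \<epsilon> powr (2 * H)" by simp
      note bound = scaled_variation_second_moment[where D = "OU \<epsilon>" and p = "2 * H", OF prob_space_axioms d[OF elim(1)] elim(2) this
          OU_meas[OF elim(1)] OU_int[OF elim(1)] OU_le[OF elim(1)]]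
      have "(\<epsilon> / d \<epsilon>) powr (2 * H) = \<epsilon> powr (2 * H) / d \<epsilon> powr (2 * H)"
        using elim d[OF elim(1)] by (simp add: powr_divide)
      with bound show ?case by (simp add: scaled_variation_nonneg)
    qed
  qed
  have X_meas: "X \<epsilon> t \<in> borel_measurable M" if "0 < \<epsilon>" "0 \<le> t" for \<epsilon> t
    by (rule X_measurable[OF kin[OF that(1)] that(1) assms(3) that(2)])
  show ?thesis
    unfolding \<kappa>_def[symmetric]
  proof (rule tendsto_in_prob_by_continuous_bound[OF prob_space_axioms v w,
        where g = "\<lambda>z. \<bar>fst z - \<kappa>\<bar> + sqrt (snd z) * (2 * sqrt (fst z) + sqrt (snd z))"])
    show "isCont (\<lambda>z. \<bar>fst z - \<kappa>\<bar> + sqrt (snd z) * (2 * sqrt (fst z) + sqrt (snd z))) (\<kappa>, 0)"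
      by (intro continuous_intros)
    show "\<forall>\<^sub>F \<epsilon> in at_right 0. (\<lambda>\<omega>. scaled_variation (2 * H) (n \<epsilon>) (d \<epsilon>) (\<lambda>t. X \<epsilon> t \<omega>) / (\<sigma>1 * \<sigma>2)\<^sup>2) \<in> borel_measurable M"
      using pos
    proof eventually_elim
      case (elim \<epsilon>)
      show ?case
        unfolding scaled_variation_def second_diff_def using d[OF elim]
        by (intro borel_measurable_divide borel_measurable_sum borel_measurable_power borel_measurable_add
            borel_measurable_diff borel_measurable_times borel_measurable_const X_meas[OF elim]) auto
    qed
    show "\<forall>\<^sub>F \<epsilon> in at_right 0. AE \<omega> in M.
        \<bar>scaled_variation (2 * H) (n \<epsilon>) (d \<epsilon>) (\<lambda>t. X \<epsilon> t \<omega>) / (\<sigma>1 * \<sigma>2)\<^sup>2 - \<kappa>\<bar>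
        \<le> \<bar>fst (scaled_variation (2 * H) (n \<epsilon>) (d \<epsilon>) (\<lambda>t. B t \<omega>), scaled_variation (2 * H) (n \<epsilon>) (d \<epsilon>) (\<lambda>t. OU \<epsilon> t \<omega>)) - \<kappa>\<bar>
          + sqrt (snd (scaled_variation (2 * H) (n \<epsilon>) (d \<epsilon>) (\<lambda>t. B t \<omega>), scaled_variation (2 * H) (n \<epsilon>) (d \<epsilon>) (\<lambda>t. OU \<epsilon> t \<omega>)))
          * (2 * sqrt (fst (scaled_variation (2 * H) (n \<epsilon>) (d \<epsilon>) (\<lambda>t. B t \<omega>), scaled_variation (2 * H) (n \<epsilon>) (d \<epsilon>) (\<lambda>t. OU \<epsilon> t \<omega>)))
             + sqrt (snd (scaled_variation (2 * H) (n \<epsilon>) (d \<epsilon>) (\<lambda>t. B t \<omega>), scaled_variation (2 * H) (n \<epsilon>) (d \<epsilon>) (\<lambda>t. OU \<epsilon> t \<omega>))))"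
      using pos
    proof eventually_elim
      case (elim \<epsilon>)
      from AE_X_eq[OF kin[OF elim] elim assms(3)] show ?case
      proof eventually_elim
        case (elim \<omega>)
        have X_eq: "X \<epsilon> t \<omega> = x0 + \<sigma>1 * \<sigma>2 * ((B t \<omega> - B 0 \<omega>) - (OU \<epsilon> t \<omega> - OU \<epsilon> 0 \<omega>))" if "0 \<le> t" for t
          unfolding OU_def using elim that by blast
        have "second_diff (\<lambda>t. X \<epsilon> t \<omega>) (d \<epsilon>) k = \<sigma>1 * \<sigma>2 * second_diff (\<lambda>t. B t \<omega> - OU \<epsilon> t \<omega>) (d \<epsilon>) k"
          if "k \<in> {2..n \<epsilon>}" for k
        proof -
          have "0 \<le> real k * d \<epsilon>" "0 \<le> (real k - 1) * d \<epsilon>" "0 \<le> (real k - 2) * d \<epsilon>"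
            using that d[OF \<open>0 < \<epsilon>\<close>] by (auto intro!: mult_nonneg_nonneg)
          then show ?thesis unfolding second_diff_def by (simp only: X_eq) (simp add: algebra_simps)
        qed
        then have "(\<Sum>k=2..n \<epsilon>. (second_diff (\<lambda>t. X \<epsilon> t \<omega>) (d \<epsilon>) k)\<^sup>2)
            = (\<Sum>k=2..n \<epsilon>. (\<sigma>1 * \<sigma>2)\<^sup>2 * (second_diff (\<lambda>t. B t \<omega> - OU \<epsilon> t \<omega>) (d \<epsilon>) k)\<^sup>2)"
          by (intro sum.cong refl) (simp only: power_mult_distrib)
        then have "scaled_variation (2 * H) (n \<epsilon>) (d \<epsilon>) (\<lambda>t. X \<epsilon> t \<omega>) / (\<sigma>1 * \<sigma>2)\<^sup>2
            = scaled_variation (2 * H) (n \<epsilon>) (d \<epsilon>) (\<lambda>t. B t \<omega> - OU \<epsilon> t \<omega>)"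
          using assms(2,3) unfolding scaled_variation_def sum_distrib_left[symmetric] by simp
        then show ?case
          by (simp only: fst_conv snd_conv scaled_variation_diff)
      qed
    qed
  qed simp
qed

text \<open>
  Normalizing both sums changes their ratio by the factor \<open>2 * 2 powr (- p)\<close>.  The identity also holds in
  the degenerate case, where both sides divide by zero.
\<close>
lemma hurst_estimator_eq:
  assumes "0 < n" "0 < d" "c \<noteq> 0"
  shows "hurst_estimator n d x = 1 / 2 - 1 / (2 * ln 2) *
    ln (2 * 2 powr (- p) * (scaled_variation p (2 * n) (d / 2) x / c) / (scaled_variation p n d x / c))"
proof -
  have half: "(d / 2) powr p = d powr p * 2 powr (- p)"
    unfolding powr_minus divide_inverse[symmetric] by (rule powr_divide)
  have cancel: "2 * r * (s / (2 * N * (q * r)) / c) / (t / (N * q) / c) = s / t"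
    if "r \<noteq> 0" "N \<noteq> 0" "q \<noteq> 0" for r s t N q :: real
    using that assms(3) by (cases "t = 0") (simp_all add: field_simps)
  have "2 * 2 powr (- p) * (scaled_variation p (2 * n) (d / 2) x / c) / (scaled_variation p n d x / c)
     = (\<Sum>k=2..2*n. (second_diff x (d / 2) k)\<^sup>2) / (\<Sum>k=2..n. (second_diff x d k)\<^sup>2)"
    unfolding scaled_variation_def half of_nat_mult of_nat_numeral
    by (rule cancel) (use assms in auto)
  then show ?thesis by (simp only: hurst_estimator_def)
qed

theorem proposition7p1:
  fixes M :: "'a measure"
    and B :: "real \<Rightarrow> 'a \<Rightarrow> real"
    and X Y :: "real \<Rightarrow> real \<Rightarrow> 'a \<Rightarrow> real"
    and H T \<sigma>1 \<sigma>2 x0 :: real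
    and n :: "real \<Rightarrow> nat"
    and \<delta> :: "real \<Rightarrow> real"
  assumes "prob_space M"
    and "0 < H" and "H < 1"
    and "0 < T"
    and "\<sigma>1 \<noteq> 0" and "\<sigma>2 \<noteq> 0"
    and "fractional_brownian_motion M H B"
    and "\<And>\<epsilon>. \<epsilon> > 0 \<Longrightarrow> kinetic_fBm M B H \<sigma>1 \<sigma>2 x0 \<epsilon> (X \<epsilon>) (Y \<epsilon>)"
    and "\<And>\<epsilon>. \<epsilon> > 0 \<Longrightarrow> n \<epsilon> \<ge> 2"
    and "\<And>\<epsilon>. \<epsilon> > 0 \<Longrightarrow> \<delta> \<epsilon> = T / real (n \<epsilon>)"
    and "(\<delta> \<longlongrightarrow> 0) (at_right 0)"
    and "((\<lambda>\<epsilon>. \<epsilon> / \<delta> \<epsilon>) \<longlongrightarrow> 0) (at_right 0)"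
  shows "tendsto_in_prob M (\<lambda>\<epsilon> \<omega>. hurst_estimator (n \<epsilon>) (\<delta> \<epsilon>) (\<lambda>t. X \<epsilon> t \<omega>)) H (at_right 0)"
proof -
  have fBm: "fBm M H B"
    using assms by (simp add: fBm_def fBm_axioms_def)
  have pos: "\<forall>\<^sub>F \<epsilon> in at_right 0. (0 :: real) < \<epsilon>"
    by (rule eventually_at_right_less)
  have n_pos: "0 < n \<epsilon>" if "0 < \<epsilon>" for \<epsilon>
    using assms(9)[OF that] by simp
  have \<delta>_pos: "0 < \<delta> \<epsilon>" if "0 < \<epsilon>" for \<epsilon>
    using assms(10)[OF that] n_pos[OF that] \<open>0 < T\<close> by simp
  have n_lim: "filterlim n sequentially (at_right 0)"
  proof -
    have "filterlim \<delta> (at_right 0) (at_right 0)"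
      unfolding filterlim_at
    proof
      show "\<forall>\<^sub>F \<epsilon> in at_right 0. \<delta> \<epsilon> \<in> {0<..} \<and> \<delta> \<epsilon> \<noteq> 0"
        by (rule eventually_mono[OF pos]) (use \<delta>_pos in force)
    qed (rule assms(11))
    then have "filterlim (\<lambda>\<epsilon>. T * inverse (\<delta> \<epsilon>)) at_top (at_right 0)"
      using \<open>0 < T\<close> by (intro filterlim_tendsto_pos_mult_at_top[OF tendsto_const]
          filterlim_compose[OF filterlim_inverse_at_top_right])
    moreover have eq: "\<forall>\<^sub>F \<epsilon> in at_right 0. T * inverse (\<delta> \<epsilon>) = real (n \<epsilon>)"
      using pos
    proof eventually_elim
      case (elim \<epsilon>)
      then show ?case using assms(10)[OF elim] n_pos[OF elim] \<open>0 < T\<close> by simp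
    qed
    ultimately have "filterlim (\<lambda>\<epsilon>. real (n \<epsilon>)) at_top (at_right 0)"
      using filterlim_cong[OF refl refl eq] by blast
    then show ?thesis by (simp add: filterlim_sequentially_iff_filterlim_real)
  qed
  define \<kappa> where "\<kappa> = 4 - 2 powr (2 * H)"
  have "(2 :: real) powr (2 * H) < 2 powr 2"
    using \<open>H < 1\<close> by (intro powr_less_mono) auto
  then have "0 < \<kappa>" by (simp add: \<kappa>_def)
  define U where "U \<epsilon> \<omega> = scaled_variation (2 * H) (n \<epsilon>) (\<delta> \<epsilon>) (\<lambda>t. X \<epsilon> t \<omega>) / (\<sigma>1 * \<sigma>2)\<^sup>2" for \<epsilon> \<omega>
  define W where "W \<epsilon> \<omega> = scaled_variation (2 * H) (2 * n \<epsilon>) (\<delta> \<epsilon> / 2) (\<lambda>t. X \<epsilon> t \<omega>) / (\<sigma>1 * \<sigma>2)\<^sup>2" for \<epsilon> \<omega>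
  have U: "tendsto_in_prob M U \<kappa> (at_right 0)"
    unfolding U_def[abs_def] \<kappa>_def
    by (rule scaled_variation_X_tendsto[OF fBm assms(5,6,8) n_lim \<delta>_pos assms(12)])
  have W: "tendsto_in_prob M W \<kappa> (at_right 0)"
    unfolding W_def[abs_def] \<kappa>_def
  proof (rule scaled_variation_X_tendsto[OF fBm assms(5,6,8)])
    show "filterlim (\<lambda>\<epsilon>. 2 * n \<epsilon>) sequentially (at_right 0)"
      by (rule filterlim_compose[OF _ n_lim]) (rule mult_nat_left_at_top, simp)
    have "((\<lambda>\<epsilon>. 2 * (\<epsilon> / \<delta> \<epsilon>)) \<longlongrightarrow> 0) (at_right 0)"
      by (rule tendsto_mult_right_zero[OF assms(12)])
    then show "((\<lambda>\<epsilon>. \<epsilon> / (\<delta> \<epsilon> / 2)) \<longlongrightarrow> 0) (at_right 0)" by (simp add: mult.commute)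
  qed (use \<delta>_pos in auto)
  define h where "h u w = 1 / 2 - 1 / (2 * ln 2) * ln (2 * 2 powr (- (2 * H)) * w / u)" for u w :: real
  have estimator: "hurst_estimator (n \<epsilon>) (\<delta> \<epsilon>) (\<lambda>t. X \<epsilon> t \<omega>) = h (U \<epsilon> \<omega>) (W \<epsilon> \<omega>)" if "0 < \<epsilon>" for \<epsilon> \<omega>
    unfolding h_def U_def W_def using \<delta>_pos[OF that] n_pos[OF that] assms(5,6) by (intro hurst_estimator_eq) auto
  have h_\<kappa>: "h \<kappa> \<kappa> = H"
  proof -
    have "ln (2 * 2 powr (- (2 * H)) * \<kappa> / \<kappa>) = (1 - 2 * H) * ln 2"
      using \<open>0 < \<kappa>\<close> by (simp add: ln_mult ln_powr algebra_simps)
    then show ?thesis by (simp add: h_def field_simps)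
  qed
  show ?thesis
  proof (rule tendsto_in_prob_by_continuous_bound[OF assms(1) U W, where g = "\<lambda>z. \<bar>h (fst z) (snd z) - H\<bar>"])
    show "isCont (\<lambda>z. \<bar>h (fst z) (snd z) - H\<bar>) (\<kappa>, \<kappa>)"
      unfolding h_def using \<open>0 < \<kappa>\<close> by (intro continuous_intros isCont_ln' isCont_divide) auto
    have "\<forall>\<^sub>F \<epsilon> in at_right 0. U \<epsilon> \<in> borel_measurable M" "\<forall>\<^sub>F \<epsilon> in at_right 0. W \<epsilon> \<in> borel_measurable M"
      using U W by (simp_all add: tendsto_in_prob_def)
    with pos show "\<forall>\<^sub>F \<epsilon> in at_right 0. (\<lambda>\<omega>. hurst_estimator (n \<epsilon>) (\<delta> \<epsilon>) (\<lambda>t. X \<epsilon> t \<omega>)) \<in> borel_measurable M"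
    proof eventually_elim
      case (elim \<epsilon>)
      note [measurable] = elim(2,3)
      show ?case unfolding estimator[OF elim(1)] h_def by measurable
    qed
    show "\<forall>\<^sub>F \<epsilon> in at_right 0. AE \<omega> in M. \<bar>hurst_estimator (n \<epsilon>) (\<delta> \<epsilon>) (\<lambda>t. X \<epsilon> t \<omega>) - H\<bar>
        \<le> \<bar>h (fst (U \<epsilon> \<omega>, W \<epsilon> \<omega>)) (snd (U \<epsilon> \<omega>, W \<epsilon> \<omega>)) - H\<bar>"
      using pos by eventually_elim (simp add: estimator)
  qed (simp add: h_\<kappa>)
qed

end
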